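(* $\Pi^1_1\text{-}\mathsf{CA}_0$ proves the statement "Every infinite partial order with no infinite antichain has a $(0,\mathrm{cof})$-homogeneous chain."
   Context: We work in second-order arithmetic; all partial orders have domain a subset of $\mathbb{N}$. $\mathsf{RCA}_0$ is the usual base system (discretely ordered commutative semi-ring axioms for $\mathbb{N}$, $\Sigma^0_1$ induction, $\Delta^0_1$ comprehension), and $\Pi^1_1\text{-}\mathsf{CA}_0$ is $\mathsf{RCA}_0$ plus the scheme of universal closures of $\exists X\,\forall n\,(n\in X\leftrightarrow\varphi(n))$ for $\Pi^1_1$ formulas $\varphi$ in which $X$ is not free. In a partial order $(P,<_P)$, elements $p,q$ are comparable if $p\leq_P q$ or $q\leq_P p$; a chain is a set of pairwise comparable elements and an antichain is a set of pairwise incomparable elements. An infinite chain $C\subseteq P$ is $(0,\mathrm{cof})$-homogeneous for $P$ if every $p\in P$ is comparable with either no element of $C$ or cofinitely many elements of $C$. *)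

theory Defs
  imports Main
begin

text \<open>
  Variables are de Bruijn indices. Each sort has its own indices: a number quantifier binds number
  variable 0 and leaves the set variables alone, and conversely. As usual for second-order
  arithmetic, equality is primitive for numbers only.
\<close>

datatype tm = Var nat | NZero | NOne | Add tm tm | Mul tm tm

datatype fm =
    Eq tm tm
  | Less tm tm
  | Mem tm nat
  | Falsum
  | Imp fm fm
  | AllN fm
  | AllS fm

abbreviation Neg :: "fm \<Rightarrow> fm" where "Neg \<phi> \<equiv> Imp \<phi> Falsum"
abbreviation Disj :: "fm \<Rightarrow> fm \<Rightarrow> fm" where "Disj \<phi> \<psi> \<equiv> Imp (Neg \<phi>) \<psi>"
abbreviation Conj :: "fm \<Rightarrow> fm \<Rightarrow> fm" where "Conj \<phi> \<psi> \<equiv> Neg (Imp \<phi> (Neg \<psi>))"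
abbreviation Iff :: "fm \<Rightarrow> fm \<Rightarrow> fm" where "Iff \<phi> \<psi> \<equiv> Conj (Imp \<phi> \<psi>) (Imp \<psi> \<phi>)"
abbreviation ExN :: "fm \<Rightarrow> fm" where "ExN \<phi> \<equiv> Neg (AllN (Neg \<phi>))"
abbreviation ExS :: "fm \<Rightarrow> fm" where "ExS \<phi> \<equiv> Neg (AllS (Neg \<phi>))"

primrec tsub :: "(nat \<Rightarrow> tm) \<Rightarrow> tm \<Rightarrow> tm" where
  "tsub \<sigma> (Var i) = \<sigma> i"
| "tsub \<sigma> NZero = NZero"
| "tsub \<sigma> NOne = NOne"
| "tsub \<sigma> (Add s t) = Add (tsub \<sigma> s) (tsub \<sigma> t)"
| "tsub \<sigma> (Mul s t) = Mul (tsub \<sigma> s) (tsub \<sigma> t)"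

abbreviation tlift :: "tm \<Rightarrow> tm" where
  "tlift \<equiv> tsub (\<lambda>i. Var (Suc i))"

primrec nsub :: "(nat \<Rightarrow> tm) \<Rightarrow> fm \<Rightarrow> fm" where
  "nsub \<sigma> (Eq s t) = Eq (tsub \<sigma> s) (tsub \<sigma> t)"
| "nsub \<sigma> (Less s t) = Less (tsub \<sigma> s) (tsub \<sigma> t)"
| "nsub \<sigma> (Mem t X) = Mem (tsub \<sigma> t) X"
| "nsub \<sigma> Falsum = Falsum"
| "nsub \<sigma> (Imp \<phi> \<psi>) = Imp (nsub \<sigma> \<phi>) (nsub \<sigma> \<psi>)"
| "nsub \<sigma> (AllN \<phi>) = AllN (nsub (case_nat (Var 0) (\<lambda>i. tlift (\<sigma> i))) \<phi>)"
| "nsub \<sigma> (AllS \<phi>) = AllS (nsub \<sigma> \<phi>)"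

primrec sren :: "(nat \<Rightarrow> nat) \<Rightarrow> fm \<Rightarrow> fm" where
  "sren \<rho> (Eq s t) = Eq s t"
| "sren \<rho> (Less s t) = Less s t"
| "sren \<rho> (Mem t X) = Mem t (\<rho> X)"
| "sren \<rho> Falsum = Falsum"
| "sren \<rho> (Imp \<phi> \<psi>) = Imp (sren \<rho> \<phi>) (sren \<rho> \<psi>)"
| "sren \<rho> (AllN \<phi>) = AllN (sren \<rho> \<phi>)"
| "sren \<rho> (AllS \<phi>) = AllS (sren (case_nat 0 (\<lambda>i. Suc (\<rho> i))) \<phi>)"

abbreviation nlift :: "fm \<Rightarrow> fm" where
  "nlift \<equiv> nsub (\<lambda>i. Var (Suc i))"

abbreviation slift :: "fm \<Rightarrow> fm" where
  "slift \<equiv> sren Suc"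

abbreviation ninst :: "tm \<Rightarrow> fm \<Rightarrow> fm" where
  "ninst t \<equiv> nsub (case_nat t Var)"

abbreviation sinst :: "nat \<Rightarrow> fm \<Rightarrow> fm" where
  "sinst X \<equiv> sren (case_nat X (\<lambda>i. i))"

primrec tclosed_at :: "nat \<Rightarrow> tm \<Rightarrow> bool" where
  "tclosed_at n (Var i) = (i < n)"
| "tclosed_at n NZero = True"
| "tclosed_at n NOne = True"
| "tclosed_at n (Add s t) = (tclosed_at n s \<and> tclosed_at n t)"
| "tclosed_at n (Mul s t) = (tclosed_at n s \<and> tclosed_at n t)"

text \<open>All free number variables are below \<open>n\<close>, all free set variables below \<open>m\<close>.\<close>

primrec closed_at :: "nat \<Rightarrow> nat \<Rightarrow> fm \<Rightarrow> bool" where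
  "closed_at n m (Eq s t) = (tclosed_at n s \<and> tclosed_at n t)"
| "closed_at n m (Less s t) = (tclosed_at n s \<and> tclosed_at n t)"
| "closed_at n m (Mem t X) = (tclosed_at n t \<and> X < m)"
| "closed_at n m Falsum = True"
| "closed_at n m (Imp \<phi> \<psi>) = (closed_at n m \<phi> \<and> closed_at n m \<psi>)"
| "closed_at n m (AllN \<phi>) = closed_at (Suc n) m \<phi>"
| "closed_at n m (AllS \<phi>) = closed_at n (Suc m) \<phi>"

definition univ_closures :: "fm \<Rightarrow> fm set" where
  "univ_closures \<phi> = {(AllS ^^ m) ((AllN ^^ n) \<phi>) | n m. closed_at n m \<phi>}"

text \<open>
  Classical natural deduction. Lifting the context in \<open>AllNI\<close> and \<open>AllSI\<close> takes the place of the
  eigenvariable condition. Contexts may be infinite, so that axiom systems can be used as contexts;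
  a derivation is a finite tree and uses only finitely many members.
\<close>

inductive derives :: "fm set \<Rightarrow> fm \<Rightarrow> bool" (infix "\<turnstile>" 50) where
  Assm: "\<phi> \<in> \<Gamma> \<Longrightarrow> \<Gamma> \<turnstile> \<phi>"
| ImpI: "insert \<phi> \<Gamma> \<turnstile> \<psi> \<Longrightarrow> \<Gamma> \<turnstile> Imp \<phi> \<psi>"
| ImpE: "\<Gamma> \<turnstile> Imp \<phi> \<psi> \<Longrightarrow> \<Gamma> \<turnstile> \<phi> \<Longrightarrow> \<Gamma> \<turnstile> \<psi>"
| Contr: "insert (Neg \<phi>) \<Gamma> \<turnstile> Falsum \<Longrightarrow> \<Gamma> \<turnstile> \<phi>"
| AllNI: "nlift ` \<Gamma> \<turnstile> \<phi> \<Longrightarrow> \<Gamma> \<turnstile> AllN \<phi>"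
| AllNE: "\<Gamma> \<turnstile> AllN \<phi> \<Longrightarrow> \<Gamma> \<turnstile> ninst t \<phi>"
| AllSI: "slift ` \<Gamma> \<turnstile> \<phi> \<Longrightarrow> \<Gamma> \<turnstile> AllS \<phi>"
| AllSE: "\<Gamma> \<turnstile> AllS \<phi> \<Longrightarrow> \<Gamma> \<turnstile> sinst X \<phi>"
| EqRefl: "\<Gamma> \<turnstile> Eq t t"
| EqSubst: "\<Gamma> \<turnstile> Eq s t \<Longrightarrow> \<Gamma> \<turnstile> ninst s \<phi> \<Longrightarrow> \<Gamma> \<turnstile> ninst t \<phi>"

text \<open>The bound \<open>t\<close> of a bounded quantifier is lifted, so the quantified variable is not in it.\<close>

inductive delta00 :: "fm \<Rightarrow> bool" where
  "delta00 (Eq s t)"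
| "delta00 (Less s t)"
| "delta00 (Mem t X)"
| "delta00 Falsum"
| "delta00 \<phi> \<Longrightarrow> delta00 \<psi> \<Longrightarrow> delta00 (Imp \<phi> \<psi>)"
| "delta00 \<phi> \<Longrightarrow> delta00 (AllN (Imp (Less (Var 0) (tlift t)) \<phi>))"
| "delta00 \<phi> \<Longrightarrow> delta00 (ExN (Conj (Less (Var 0) (tlift t)) \<phi>))"

definition sigma01 :: "fm \<Rightarrow> bool" where
  "sigma01 \<phi> \<longleftrightarrow> (\<exists>\<theta>. \<phi> = ExN \<theta> \<and> delta00 \<theta>)"

definition pi01 :: "fm \<Rightarrow> bool" where
  "pi01 \<phi> \<longleftrightarrow> (\<exists>\<theta>. \<phi> = AllN \<theta> \<and> delta00 \<theta>)"

primrec arithmetical :: "fm \<Rightarrow> bool" where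
  "arithmetical (Eq s t) = True"
| "arithmetical (Less s t) = True"
| "arithmetical (Mem t X) = True"
| "arithmetical Falsum = True"
| "arithmetical (Imp \<phi> \<psi>) = (arithmetical \<phi> \<and> arithmetical \<psi>)"
| "arithmetical (AllN \<phi>) = arithmetical \<phi>"
| "arithmetical (AllS \<phi>) = False"

definition pi11 :: "fm \<Rightarrow> bool" where
  "pi11 \<phi> \<longleftrightarrow> (\<exists>\<theta>. \<phi> = AllS \<theta> \<and> arithmetical \<theta>)"

text \<open>
  The axioms of discretely ordered commutative semirings (the theory usually called
  \<open>PA\<close>-minus), as open formulas.
\<close>

definition semiring_axioms :: "fm set" where
  "semiring_axioms = (let x = Var 0; y = Var 1; z = Var 2 in
    { Eq (Add (Add x y) z) (Add x (Add y z)),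
      Eq (Add x y) (Add y x),
      Eq (Mul (Mul x y) z) (Mul x (Mul y z)),
      Eq (Mul x y) (Mul y x),
      Eq (Mul x (Add y z)) (Add (Mul x y) (Mul x z)),
      Eq (Add x NZero) x,
      Eq (Mul x NZero) NZero,
      Eq (Mul x NOne) x,
      Imp (Conj (Less x y) (Less y z)) (Less x z),
      Neg (Less x x),
      Disj (Less x y) (Disj (Eq x y) (Less y x)),
      Imp (Less x y) (Less (Add x z) (Add y z)),
      Imp (Conj (Less NZero z) (Less x y)) (Less (Mul x z) (Mul y z)),
      Imp (Less x y) (ExN (Eq (Add (tlift x) (Var 0)) (tlift y))),
      Less NZero NOne,
      Imp (Less NZero x) (Disj (Eq NOne x) (Less NOne x)),
      Disj (Eq NZero x) (Less NZero x) })"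

text \<open>
  In the schemes below, number variable 0 of \<open>\<phi>\<close> (and \<open>\<psi>\<close>) is the distinguished variable \<open>n\<close>;
  all other variables are parameters. The set quantified in a comprehension axiom does not occur
  in \<open>\<phi>\<close> because of the lifting.
\<close>

definition induction_ax :: "fm \<Rightarrow> fm" where
  "induction_ax \<phi> =
     Imp (Conj (ninst NZero \<phi>) (AllN (Imp \<phi> (nsub (Var(0 := Add (Var 0) NOne)) \<phi>)))) (AllN \<phi>)"

definition comprehension_ax :: "fm \<Rightarrow> fm" where
  "comprehension_ax \<phi> = ExS (AllN (Iff (Mem (Var 0) 0) (slift \<phi>)))"

definition delta01_comprehension_ax :: "fm \<Rightarrow> fm \<Rightarrow> fm" where
  "delta01_comprehension_ax \<phi> \<psi> = Imp (AllN (Iff \<phi> \<psi>)) (comprehension_ax \<phi>)"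

definition RCA0 :: "fm set" where
  "RCA0 = (\<Union>\<phi> \<in> semiring_axioms
                 \<union> {induction_ax \<phi> | \<phi>. sigma01 \<phi>}
                 \<union> {delta01_comprehension_ax \<phi> \<psi> | \<phi> \<psi>. sigma01 \<phi> \<and> pi01 \<psi>}.
             univ_closures \<phi>)"

definition Pi11CA0 :: "fm set" where
  "Pi11CA0 = RCA0 \<union> (\<Union>\<phi> \<in> {comprehension_ax \<phi> | \<phi>. pi11 \<phi>}. univ_closures \<phi>)"

text \<open>
  A binary relation on numbers is a set of codes \<open>(x + y)\<^sup>2 + x\<close> of pairs \<open>(x, y)\<close>.
  Set arguments below are set variables; \<open>R\<close> is the strict order \<open><\<^sub>P\<close> of the partial order.
\<close>

definition pair_tm :: "tm \<Rightarrow> tm \<Rightarrow> tm" where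
  "pair_tm s t = Add (Mul (Add s t) (Add s t)) s"

definition rel_fm :: "nat \<Rightarrow> tm \<Rightarrow> tm \<Rightarrow> fm" where
  "rel_fm R s t = Mem (pair_tm s t) R"

definition partial_order_fm :: "nat \<Rightarrow> nat \<Rightarrow> fm" where
  "partial_order_fm P R =
     Conj (AllN (Imp (Mem (Var 0) R)
             (ExN (ExN (Conj (Conj (Mem (Var 1) P) (Mem (Var 0) P))
                             (Eq (Var 2) (pair_tm (Var 1) (Var 0))))))))
    (Conj (AllN (Neg (rel_fm R (Var 0) (Var 0))))
          (AllN (AllN (AllN (Imp (Conj (rel_fm R (Var 2) (Var 1)) (rel_fm R (Var 1) (Var 0)))
                                 (rel_fm R (Var 2) (Var 0)))))))"

definition leq_fm :: "nat \<Rightarrow> tm \<Rightarrow> tm \<Rightarrow> fm" where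
  "leq_fm R s t = Disj (rel_fm R s t) (Eq s t)"

definition comparable_fm :: "nat \<Rightarrow> tm \<Rightarrow> tm \<Rightarrow> fm" where
  "comparable_fm R s t = Disj (leq_fm R s t) (leq_fm R t s)"

definition subset_fm :: "nat \<Rightarrow> nat \<Rightarrow> fm" where
  "subset_fm X Y = AllN (Imp (Mem (Var 0) X) (Mem (Var 0) Y))"

text \<open>As usual in second-order arithmetic, a set is infinite iff it is unbounded.\<close>

definition infinite_fm :: "nat \<Rightarrow> fm" where
  "infinite_fm X = AllN (ExN (Conj (Less (Var 1) (Var 0)) (Mem (Var 0) X)))"

definition chain_fm :: "nat \<Rightarrow> nat \<Rightarrow> nat \<Rightarrow> fm" where
  "chain_fm P R C =
     Conj (subset_fm C P)
          (AllN (AllN (Imp (Conj (Mem (Var 1) C) (Mem (Var 0) C))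
                           (comparable_fm R (Var 1) (Var 0)))))"

definition antichain_fm :: "nat \<Rightarrow> nat \<Rightarrow> nat \<Rightarrow> fm" where
  "antichain_fm P R A =
     Conj (subset_fm A P)
          (AllN (AllN (Imp (Conj (Conj (Mem (Var 1) A) (Mem (Var 0) A)) (Neg (Eq (Var 1) (Var 0))))
                           (Neg (comparable_fm R (Var 1) (Var 0))))))"

text \<open>
  In the first disjunct \<open>Var 1\<close> is \<open>p\<close> and \<open>Var 0\<close> is \<open>c\<close>. In the second one \<open>p\<close> is \<open>Var 2\<close>, and
  \<open>Var 1\<close> is a bound beyond which all elements \<open>c\<close> of \<open>C\<close> are comparable with \<open>p\<close>.
\<close>

definition zero_cof_homogeneous_chain_fm :: "nat \<Rightarrow> nat \<Rightarrow> nat \<Rightarrow> fm" where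
  "zero_cof_homogeneous_chain_fm P R C =
     Conj (Conj (infinite_fm C) (chain_fm P R C))
          (AllN (Imp (Mem (Var 0) P)
             (Disj (AllN (Imp (Mem (Var 0) C) (Neg (comparable_fm R (Var 1) (Var 0)))))
                   (ExN (AllN (Imp (Conj (Mem (Var 0) C) (Less (Var 1) (Var 0)))
                                   (comparable_fm R (Var 2) (Var 0))))))))"

text \<open>Under two set quantifiers \<open>P\<close> is 1 and \<open>R\<close> is 0; under three they are 2 and 1.\<close>

definition homogeneous_chain_principle :: fm where
  "homogeneous_chain_principle =
     AllS (AllS (Imp
       (Conj (Conj (partial_order_fm 1 0) (infinite_fm 1))
             (Neg (ExS (Conj (infinite_fm 0) (antichain_fm 2 1 0)))))
       (ExS (zero_cof_homogeneous_chain_fm 2 1 0))))"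

end

theory Submission
  imports Defs "HOL-Library.Countable_Set"
begin

text \<open>
  By a completeness theorem for the calculus it suffices to verify the principle in every structure
  for the language of second-order arithmetic that satisfies the axioms, with equality of numbers
  interpreted as identity. Such a structure may be nonstandard, both in its numbers and in its
  sets, so inside it induction is available for coded sets only, that is, for the sets of numbers
  that some set object of the structure represents. By comprehension every set that is defined by
  an arithmetical condition, preceded by at most one set quantifier, is coded; parameters are
  allowed.

  Let \<open>P\<close> be an unbounded coded partial order without unbounded coded antichains. Let \<open>Asc\<close> consist
  of the members of coded subsets of \<open>P\<close> without maximal elements; it is defined by one existential
  set quantifier. If \<open>Asc\<close> is empty both for \<open>P\<close> and for the reversed order, then every nonempty
  coded subset of \<open>P\<close> has maximal and minimal elements, which allows thinning \<open>P\<close> out to an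
  unbounded subset in which each element is comparable with boundedly many elements only, and
  an antichain is then chosen greedily, a contradiction. By symmetry, suppose that \<open>Asc\<close> is
  nonempty.

  Then there is an unbounded chain \<open>C \<subseteq> Asc\<close> on which the order of \<open>P\<close> agrees with that of the
  numbers, and whose downward closure is maximal in the following sense: if \<open>m\<close> has a common upper
  bound in \<open>Asc\<close> with each element of \<open>C\<close>, then \<open>m\<close> lies below some element of \<open>C\<close>
  (\<open>maximal_ascending_chain\<close>). It arises by always passing to an element above the least \<open>m\<close>
  that has such a bound with the current element without lying below it. The elements that can spoil the homogeneity of \<open>C\<close> form the
  set \<open>B\<close> of those that are neither below an element of \<open>C\<close> nor above all of \<open>C\<close>. Call \<open>b \<in> B\<close>
  terminal if for some \<open>k \<in> C\<close> no \<open>q \<in> B\<close> above \<open>b\<close> is above \<open>k\<close>. If every \<open>c \<in> C\<close> has a terminal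
  element above it, then terminal elements can be chosen greedily to form an unbounded antichain.
  So some \<open>c \<in> C\<close> has none. The elements of \<open>B\<close> above that \<open>c\<close> then form a set without maximal
  elements, hence a subset of \<open>Asc\<close>, and the maximality of \<open>C\<close> shows that there are none; the part
  of \<open>C\<close> from \<open>c\<close> on is therefore homogeneous.

  All choices along the numbers are made by one lemma, \<open>orbit\<close>: the set of iterates of an
  arithmetical step relation is the least coded set that contains the starting point and is closed
  under taking the least admissible successor. This is a definition with one universal set
  quantifier, so neither finite sequences nor pairs need to be coded inside the structure.
\<close>


section \<open>Substitution\<close>

text \<open>
  The substitution \<open>\<sigma>\<close> moved under a number quantifier; \<open>sup_ren\<close> does the same to a renaming of set
  variables under a set quantifier.
\<close>

abbreviation up :: "(nat \<Rightarrow> tm) \<Rightarrow> nat \<Rightarrow> tm" where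
  "up \<sigma> \<equiv> case_nat (Var 0) (\<lambda>i. tlift (\<sigma> i))"

abbreviation sup_ren :: "(nat \<Rightarrow> nat) \<Rightarrow> nat \<Rightarrow> nat" where
  "sup_ren \<rho> \<equiv> case_nat 0 (\<lambda>i. Suc (\<rho> i))"

lemma tsub_tsub: "tsub \<sigma> (tsub \<tau> t) = tsub (\<lambda>i. tsub \<sigma> (\<tau> i)) t"
  by (induction t) auto

lemma tsub_Var [simp]: "tsub Var t = t"
  by (induction t) auto

lemma up_up: "(\<lambda>i. tsub (up \<sigma>) (up \<tau> i)) = up (\<lambda>i. tsub \<sigma> (\<tau> i))"
  by (rule ext) (auto simp: tsub_tsub split: nat.split)

lemma nsub_nsub: "nsub \<sigma> (nsub \<tau> \<phi>) = nsub (\<lambda>i. tsub \<sigma> (\<tau> i)) \<phi>"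
  by (induction \<phi> arbitrary: \<sigma> \<tau>) (auto simp: tsub_tsub up_up)

lemma up_Var [simp]: "case_nat (Var 0) (\<lambda>i. Var (Suc i)) = Var"
  by (rule ext) (auto split: nat.split)

lemma nsub_Var [simp]: "nsub Var \<phi> = \<phi>"
  by (induction \<phi>) auto

lemma sren_sren: "sren \<rho> (sren \<pi> \<phi>) = sren (\<lambda>i. \<rho> (\<pi> i)) \<phi>"
proof (induction \<phi> arbitrary: \<rho> \<pi>)
  case (AllS \<phi>)
  have "(\<lambda>i. sup_ren \<rho> (sup_ren \<pi> i)) = sup_ren (\<lambda>i. \<rho> (\<pi> i))"
    by (rule ext) (auto split: nat.split)
  then show ?case by (simp add: AllS)
qed auto

lemma sup_ren_id [simp]: "sup_ren (\<lambda>i. i) = (\<lambda>i. i)"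
  by (rule ext) (auto split: nat.split)

lemma sren_id [simp]: "sren (\<lambda>i. i) \<phi> = \<phi>"
  by (induction \<phi>) auto

lemma nsub_sren: "nsub \<sigma> (sren \<rho> \<phi>) = sren \<rho> (nsub \<sigma> \<phi>)"
  by (induction \<phi> arbitrary: \<sigma> \<rho>) auto

lemma tsub_cong: "tclosed_at n t \<Longrightarrow> (\<And>i. i < n \<Longrightarrow> \<sigma> i = \<tau> i) \<Longrightarrow> tsub \<sigma> t = tsub \<tau> t"
  by (induction t) auto

lemma nsub_cong: "closed_at n m \<phi> \<Longrightarrow> (\<And>i. i < n \<Longrightarrow> \<sigma> i = \<tau> i) \<Longrightarrow> nsub \<sigma> \<phi> = nsub \<tau> \<phi>"
proof (induction \<phi> arbitrary: n m \<sigma> \<tau>)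
  case (Imp \<phi> \<psi>)
  then show ?case using Imp.IH[of n m \<sigma> \<tau>] by (simp only: nsub.simps closed_at.simps)
next
  case (AllN \<phi>)
  have "nsub (up \<sigma>) \<phi> = nsub (up \<tau>) \<phi>"
    by (rule AllN.IH[of "Suc n" m]) (use AllN.prems in \<open>auto split: nat.split\<close>)
  then show ?case by simp
next
  case (AllS \<phi>)
  have "nsub \<sigma> \<phi> = nsub \<tau> \<phi>"
    by (rule AllS.IH[of n "Suc m"]) (use AllS.prems in auto)
  then show ?case by simp
qed (auto intro: tsub_cong)

lemma sren_cong: "closed_at n m \<phi> \<Longrightarrow> (\<And>i. i < m \<Longrightarrow> \<rho> i = \<pi> i) \<Longrightarrow> sren \<rho> \<phi> = sren \<pi> \<phi>"
proof (induction \<phi> arbitrary: n m \<rho> \<pi>)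
  case (Imp \<phi> \<psi>)
  then show ?case using Imp.IH[of n m \<rho> \<pi>] by (simp only: sren.simps closed_at.simps)
next
  case (AllN \<phi>)
  have "sren \<rho> \<phi> = sren \<pi> \<phi>"
    by (rule AllN.IH[of "Suc n" m]) (use AllN.prems in auto)
  then show ?case by simp
next
  case (AllS \<phi>)
  have "sren (sup_ren \<rho>) \<phi> = sren (sup_ren \<pi>) \<phi>"
    by (rule AllS.IH[of n "Suc m"]) (use AllS.prems in \<open>auto split: nat.split\<close>)
  then show ?case by simp
qed auto

lemma sentence_nsub: "closed_at 0 m \<phi> \<Longrightarrow> nsub \<sigma> \<phi> = \<phi>"
  using nsub_cong[of 0 m \<phi> \<sigma> Var] by simp

lemma sentence_sren: "closed_at n 0 \<phi> \<Longrightarrow> sren \<rho> \<phi> = \<phi>"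
  using sren_cong[of n 0 \<phi> \<rho> "\<lambda>i. i"] by simp

lemma tclosed_at_mono: "tclosed_at n t \<Longrightarrow> n \<le> n' \<Longrightarrow> tclosed_at n' t"
  by (induction t) auto

lemma closed_at_mono: "closed_at n m \<phi> \<Longrightarrow> n \<le> n' \<Longrightarrow> m \<le> m' \<Longrightarrow> closed_at n' m' \<phi>"
proof (induction \<phi> arbitrary: n m n' m')
  case (AllN \<phi>)
  then show ?case using AllN.IH[of "Suc n" m "Suc n'" m'] by simp
next
  case (AllS \<phi>)
  then show ?case using AllS.IH[of n "Suc m" n' "Suc m'"] by simp
qed (auto intro: tclosed_at_mono)

lemma tclosed_at_ex: "\<exists>n. tclosed_at n t"
proof (induction t)
  case (Add s t)
  then obtain a b where "tclosed_at a s" "tclosed_at b t" by auto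
  then show ?case by (intro exI[of _ "max a b"]) (auto intro: tclosed_at_mono)
next
  case (Mul s t)
  then obtain a b where "tclosed_at a s" "tclosed_at b t" by auto
  then show ?case by (intro exI[of _ "max a b"]) (auto intro: tclosed_at_mono)
qed (auto intro: lessI)

lemma closed_at_ex: "\<exists>n. closed_at n n \<phi>"
proof (induction \<phi>)
  case (Eq s t)
  obtain a b where "tclosed_at a s" "tclosed_at b t" using tclosed_at_ex by blast
  then show ?case by (intro exI[of _ "max a b"]) (auto intro: tclosed_at_mono)
next
  case (Less s t)
  obtain a b where "tclosed_at a s" "tclosed_at b t" using tclosed_at_ex by blast
  then show ?case by (intro exI[of _ "max a b"]) (auto intro: tclosed_at_mono)
next
  case (Mem t X)
  obtain a where "tclosed_at a t" using tclosed_at_ex by blast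
  then show ?case by (intro exI[of _ "max a (Suc X)"]) (auto intro: tclosed_at_mono)
next
  case (Imp \<phi> \<psi>)
  then obtain a b where "closed_at a a \<phi>" "closed_at b b \<psi>" by auto
  then show ?case by (intro exI[of _ "max a b"]) (auto intro: closed_at_mono)
next
  case (AllN \<phi>)
  then obtain a where "closed_at a a \<phi>" by auto
  then have "closed_at (Suc a) a \<phi>" by (rule closed_at_mono) auto
  then show ?case by (intro exI[of _ a]) simp
next
  case (AllS \<phi>)
  then obtain a where "closed_at a a \<phi>" by auto
  then have "closed_at a (Suc a) \<phi>" by (rule closed_at_mono) auto
  then show ?case by (intro exI[of _ a]) simp
qed auto

lemma tclosed_at_tsub:
  "tclosed_at n t \<Longrightarrow> (\<And>i. i < n \<Longrightarrow> tclosed_at n' (\<sigma> i)) \<Longrightarrow> tclosed_at n' (tsub \<sigma> t)"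
  by (induction t) auto

lemma closed_at_nsub:
  "closed_at n m \<phi> \<Longrightarrow> (\<And>i. i < n \<Longrightarrow> tclosed_at n' (\<sigma> i)) \<Longrightarrow> closed_at n' m (nsub \<sigma> \<phi>)"
proof (induction \<phi> arbitrary: n n' m \<sigma>)
  case (AllN \<phi>)
  have "closed_at (Suc n') m (nsub (up \<sigma>) \<phi>)"
    by (rule AllN.IH[of "Suc n"])
      (use AllN.prems in \<open>auto split: nat.split intro!: tclosed_at_tsub\<close>)
  then show ?case by simp
qed (auto intro: tclosed_at_tsub)

lemma closed_at_sren:
  "closed_at n m \<phi> \<Longrightarrow> (\<And>i. i < m \<Longrightarrow> \<rho> i < m') \<Longrightarrow> closed_at n m' (sren \<rho> \<phi>)"
proof (induction \<phi> arbitrary: n m m' \<rho>)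
  case (AllS \<phi>)
  have "closed_at n (Suc m') (sren (sup_ren \<rho>) \<phi>)"
    by (rule AllS.IH[of n "Suc m"]) (use AllS.prems in \<open>auto split: nat.split\<close>)
  then show ?case by simp
qed auto


section \<open>The calculus\<close>

lemma derives_mono: "\<Gamma> \<turnstile> \<phi> \<Longrightarrow> \<Gamma> \<subseteq> \<Delta> \<Longrightarrow> \<Delta> \<turnstile> \<phi>"
proof (induction arbitrary: \<Delta> rule: derives.induct)
  case (ImpI \<phi> \<Gamma> \<psi>)
  show ?case by (rule derives.ImpI) (rule ImpI.IH, use ImpI.prems in auto)
next
  case (Contr \<phi> \<Gamma>)
  show ?case by (rule derives.Contr) (rule Contr.IH, use Contr.prems in auto)
next
  case (AllNI \<Gamma> \<phi>)
  show ?case by (rule derives.AllNI) (rule AllNI.IH, use AllNI.prems in auto)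
next
  case (AllSI \<Gamma> \<phi>)
  show ?case by (rule derives.AllSI) (rule AllSI.IH, use AllSI.prems in auto)
next
  case (Assm \<phi> \<Gamma>)
  then show ?case by (auto intro: derives.Assm)
next
  case (ImpE \<Gamma> \<phi> \<psi>)
  then show ?case by (metis derives.ImpE)
next
  case (AllNE \<Gamma> \<phi> t)
  show ?case by (rule derives.AllNE[OF AllNE.IH[OF AllNE.prems]])
next
  case (AllSE \<Gamma> \<phi> X)
  show ?case by (rule derives.AllSE[OF AllSE.IH[OF AllSE.prems]])
next
  case (EqRefl \<Gamma> t)
  show ?case by (rule derives.EqRefl)
next
  case (EqSubst \<Gamma> s t \<phi>)
  show ?case
    by (rule derives.EqSubst[OF EqSubst.IH(1)[OF EqSubst.prems] EqSubst.IH(2)[OF EqSubst.prems]])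
qed

lemma derives_finite: "\<Gamma> \<turnstile> \<phi> \<Longrightarrow> \<exists>F. finite F \<and> F \<subseteq> \<Gamma> \<and> F \<turnstile> \<phi>"
proof (induction rule: derives.induct)
  case (Assm \<phi> \<Gamma>)
  then show ?case by (intro exI[of _ "{\<phi>}"]) (auto intro: derives.Assm)
next
  case (ImpI \<phi> \<Gamma> \<psi>)
  then obtain F where F: "finite F" "F \<subseteq> insert \<phi> \<Gamma>" "F \<turnstile> \<psi>" by blast
  then have "F - {\<phi>} \<turnstile> Imp \<phi> \<psi>"
    using F(2) by (intro derives.ImpI[OF derives_mono[OF F(3)]]) auto
  then show ?case using F by (intro exI[of _ "F - {\<phi>}"]) auto
next
  case (ImpE \<Gamma> \<phi> \<psi>)
  then obtain F G where F: "finite F" "F \<subseteq> \<Gamma>" "F \<turnstile> Imp \<phi> \<psi>" "finite G" "G \<subseteq> \<Gamma>" "G \<turnstile> \<phi>" by blast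
  then have "F \<union> G \<turnstile> \<psi>"
    using derives.ImpE[OF derives_mono[OF F(3)] derives_mono[OF F(6)], of "F \<union> G"] by simp
  then show ?case using F by (intro exI[of _ "F \<union> G"]) simp
next
  case (Contr \<phi> \<Gamma>)
  then obtain F where F: "finite F" "F \<subseteq> insert (Neg \<phi>) \<Gamma>" "F \<turnstile> Falsum" by blast
  then have "F - {Neg \<phi>} \<turnstile> \<phi>"
    using F(2) by (intro derives.Contr[OF derives_mono[OF F(3)]]) auto
  then show ?case using F by (intro exI[of _ "F - {Neg \<phi>}"]) auto
next
  case (AllNI \<Gamma> \<phi>)
  then obtain F where "finite F" "F \<subseteq> nlift ` \<Gamma>" "F \<turnstile> \<phi>" by blast
  then show ?case by (metis derives.AllNI finite_subset_image)
next
  case (AllSI \<Gamma> \<phi>)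
  then obtain F where "finite F" "F \<subseteq> slift ` \<Gamma>" "F \<turnstile> \<phi>" by blast
  then show ?case by (metis derives.AllSI finite_subset_image)
next
  case (EqSubst \<Gamma> s t \<phi>)
  then obtain F G where F: "finite F" "F \<subseteq> \<Gamma>" "F \<turnstile> Eq s t" "finite G" "G \<subseteq> \<Gamma>" "G \<turnstile> ninst s \<phi>"
    by blast
  then have "F \<union> G \<turnstile> ninst t \<phi>"
    using derives.EqSubst[OF derives_mono[OF F(3)] derives_mono[OF F(6)], of "F \<union> G"] by simp
  then show ?case using F by (intro exI[of _ "F \<union> G"]) simp
next
  case (AllNE \<Gamma> \<phi> t)
  then obtain F where "finite F" "F \<subseteq> \<Gamma>" "F \<turnstile> AllN \<phi>" by blast
  then show ?case using derives.AllNE by blast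
next
  case (AllSE \<Gamma> \<phi> X)
  then obtain F where "finite F" "F \<subseteq> \<Gamma>" "F \<turnstile> AllS \<phi>" by blast
  then show ?case using derives.AllSE by blast
next
  case (EqRefl \<Gamma> t)
  show ?case by (intro exI[of _ "{}"]) (auto intro: derives.EqRefl)
qed

lemma nsub_ninst: "nsub \<sigma> (ninst t \<phi>) = ninst (tsub \<sigma> t) (nsub (up \<sigma>) \<phi>)"
proof -
  have "(\<lambda>i. tsub \<sigma> (case_nat t Var i)) = (\<lambda>i. tsub (case_nat (tsub \<sigma> t) Var) (up \<sigma> i))"
    by (rule ext) (auto simp: tsub_tsub split: nat.split)
  then show ?thesis by (simp add: nsub_nsub)
qed

lemma sren_sinst: "sren \<rho> (sinst X \<phi>) = sinst (\<rho> X) (sren (sup_ren \<rho>) \<phi>)"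
proof -
  have "(\<lambda>i. \<rho> (case_nat X (\<lambda>i. i) i)) = (\<lambda>i. case_nat (\<rho> X) (\<lambda>i. i) (sup_ren \<rho> i))"
    by (rule ext) (auto split: nat.split)
  then show ?thesis by (simp add: sren_sren)
qed

lemma derives_nsub: "\<Gamma> \<turnstile> \<phi> \<Longrightarrow> nsub \<sigma> ` \<Gamma> \<turnstile> nsub \<sigma> \<phi>"
proof (induction arbitrary: \<sigma> rule: derives.induct)
  case (ImpI \<phi> \<Gamma> \<psi>)
  then show ?case using derives.ImpI by (metis image_insert nsub.simps(5))
next
  case (ImpE \<Gamma> \<phi> \<psi>)
  then show ?case using derives.ImpE by (metis nsub.simps(5))
next
  case (Contr \<phi> \<Gamma>)
  then show ?case using derives.Contr by (metis image_insert nsub.simps(4,5))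
next
  case (AllNI \<Gamma> \<phi>)
  have "nsub (up \<sigma>) ` nlift ` \<Gamma> = nlift ` nsub \<sigma> ` \<Gamma>"
    by (simp add: image_image nsub_nsub)
  then show ?case using AllNI.IH[of "up \<sigma>"] by (auto intro: derives.AllNI)
next
  case (AllNE \<Gamma> \<phi> t)
  then have "nsub \<sigma> ` \<Gamma> \<turnstile> AllN (nsub (up \<sigma>) \<phi>)" by simp
  from derives.AllNE[OF this, of "tsub \<sigma> t"] show ?case by (simp only: nsub_ninst)
next
  case (AllSI \<Gamma> \<phi>)
  have "nsub \<sigma> ` slift ` \<Gamma> = slift ` nsub \<sigma> ` \<Gamma>"
    by (simp add: image_image nsub_sren)
  then show ?case using AllSI.IH[of \<sigma>] by (auto intro: derives.AllSI)
next
  case (AllSE \<Gamma> \<phi> X)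
  then have "nsub \<sigma> ` \<Gamma> \<turnstile> AllS (nsub \<sigma> \<phi>)" by simp
  from derives.AllSE[OF this, of X] show ?case by (simp only: nsub_sren)
next
  case (EqRefl \<Gamma> t)
  then show ?case by (auto intro: derives.EqRefl)
next
  case (EqSubst \<Gamma> s t \<phi>)
  have "nsub \<sigma> ` \<Gamma> \<turnstile> Eq (tsub \<sigma> s) (tsub \<sigma> t)" using EqSubst.IH(1) by simp
  from derives.EqSubst[OF this EqSubst.IH(2)[of \<sigma>, unfolded nsub_ninst]]
  show ?case by (simp only: nsub_ninst)
qed (auto intro: derives.Assm)

lemma derives_sren: "\<Gamma> \<turnstile> \<phi> \<Longrightarrow> sren \<rho> ` \<Gamma> \<turnstile> sren \<rho> \<phi>"
proof (induction arbitrary: \<rho> rule: derives.induct)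
  case (ImpI \<phi> \<Gamma> \<psi>)
  then show ?case using derives.ImpI by (metis image_insert sren.simps(5))
next
  case (ImpE \<Gamma> \<phi> \<psi>)
  then show ?case using derives.ImpE by (metis sren.simps(5))
next
  case (Contr \<phi> \<Gamma>)
  then show ?case using derives.Contr by (metis image_insert sren.simps(4,5))
next
  case (AllNI \<Gamma> \<phi>)
  have "sren \<rho> ` nlift ` \<Gamma> = nlift ` sren \<rho> ` \<Gamma>"
    by (simp add: image_image nsub_sren)
  then show ?case using AllNI.IH[of \<rho>] by (auto intro: derives.AllNI)
next
  case (AllNE \<Gamma> \<phi> t)
  then have "sren \<rho> ` \<Gamma> \<turnstile> AllN (sren \<rho> \<phi>)" by simp
  from derives.AllNE[OF this, of t] show ?case by (simp only: nsub_sren)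
next
  case (AllSI \<Gamma> \<phi>)
  have "sren (sup_ren \<rho>) ` slift ` \<Gamma> = slift ` sren \<rho> ` \<Gamma>"
    by (simp add: image_image sren_sren)
  then show ?case using AllSI.IH[of "sup_ren \<rho>"] by (auto intro: derives.AllSI)
next
  case (AllSE \<Gamma> \<phi> X)
  then have "sren \<rho> ` \<Gamma> \<turnstile> AllS (sren (sup_ren \<rho>) \<phi>)" by simp
  from derives.AllSE[OF this, of "\<rho> X"] show ?case by (simp only: sren_sinst)
next
  case (EqRefl \<Gamma> t)
  then show ?case by (auto intro: derives.EqRefl)
next
  case (EqSubst \<Gamma> s t \<phi>)
  have "sren \<rho> ` \<Gamma> \<turnstile> Eq s t" using EqSubst.IH(1)[of \<rho>] by simp
  from derives.EqSubst[OF this EqSubst.IH(2)[of \<rho>, folded nsub_sren]]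
  show ?case by (simp only: nsub_sren)
qed (auto intro: derives.Assm)

text \<open>
  A variable that occurs in neither the context nor \<open>\<chi>\<close> can be generalized: renaming it to 0, and
  shifting the others, turns the given derivation into one from the lifted context.
\<close>

lemma AllN_fresh:
  assumes \<Delta>: "\<And>\<psi>. \<psi> \<in> \<Delta> \<Longrightarrow> closed_at N M \<psi>" and \<chi>: "closed_at (Suc N) M \<chi>"
    and d: "\<Delta> \<turnstile> ninst (Var N) \<chi>"
  shows "\<Delta> \<turnstile> AllN \<chi>"
proof -
  define \<sigma> where "\<sigma> = (\<lambda>i. if i = N then Var 0 else Var (Suc i))"
  have "nsub \<sigma> ` \<Delta> = nlift ` \<Delta>"
    by (rule image_cong[OF refl], rule nsub_cong[OF \<Delta>]) (auto simp: \<sigma>_def)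
  moreover have "nsub \<sigma> (ninst (Var N) \<chi>) = \<chi>"
  proof -
    have "nsub \<sigma> (ninst (Var N) \<chi>) = nsub Var \<chi>"
      unfolding nsub_nsub by (rule nsub_cong[OF \<chi>]) (auto simp: \<sigma>_def split: nat.split)
    then show ?thesis by simp
  qed
  ultimately show ?thesis using derives_nsub[OF d, of \<sigma>] by (auto intro: derives.AllNI)
qed

lemma AllS_fresh:
  assumes \<Delta>: "\<And>\<psi>. \<psi> \<in> \<Delta> \<Longrightarrow> closed_at N M \<psi>" and \<chi>: "closed_at N (Suc M) \<chi>"
    and d: "\<Delta> \<turnstile> sinst M \<chi>"
  shows "\<Delta> \<turnstile> AllS \<chi>"
proof -
  define \<rho> where "\<rho> = (\<lambda>i. if i = M then 0 else Suc i)"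
  have "sren \<rho> ` \<Delta> = slift ` \<Delta>"
    by (rule image_cong[OF refl], rule sren_cong[OF \<Delta>]) (auto simp: \<rho>_def)
  moreover have "sren \<rho> (sinst M \<chi>) = \<chi>"
  proof -
    have "sren \<rho> (sinst M \<chi>) = sren (\<lambda>i. i) \<chi>"
      unfolding sren_sren by (rule sren_cong[OF \<chi>]) (auto simp: \<rho>_def split: nat.split)
    then show ?thesis by simp
  qed
  ultimately show ?thesis using derives_sren[OF d, of \<rho>] by (auto intro: derives.AllSI)
qed


section \<open>Henkin sets\<close>

instance tm :: countable by countable_datatype
instance fm :: countable by countable_datatype

abbreviation consistent :: "fm set \<Rightarrow> bool" where
  "consistent \<Delta> \<equiv> \<not> \<Delta> \<turnstile> Falsum"

text \<open>
  A set that contains \<open>\<psi>\<close> or its negation and, in the latter case, a counterexample to \<open>\<psi>\<close>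
  if \<open>\<psi>\<close> is a universal formula. Free variables serve as Henkin constants.
\<close>

definition decides :: "fm set \<Rightarrow> fm \<Rightarrow> bool" where
  "decides \<Delta> \<psi> \<longleftrightarrow> \<psi> \<in> \<Delta> \<or> Neg \<psi> \<in> \<Delta>
     \<and> (\<forall>\<chi>. \<psi> = AllN \<chi> \<longrightarrow> (\<exists>t. Neg (ninst t \<chi>) \<in> \<Delta>))
     \<and> (\<forall>\<chi>. \<psi> = AllS \<chi> \<longrightarrow> (\<exists>X. Neg (sinst X \<chi>) \<in> \<Delta>))"

text \<open>
  The bound \<open>n\<close> on the free variables of the members of \<open>\<Delta>\<close> makes sure that fresh variables exist.
\<close>

lemma decide_step:
  assumes con: "consistent \<Delta>" and cl: "\<And>\<psi>. \<psi> \<in> \<Delta> \<Longrightarrow> closed_at n n \<psi>"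
  shows "\<exists>\<Delta>' n'. consistent \<Delta>' \<and> (\<forall>\<psi>\<in>\<Delta>'. closed_at n' n' \<psi>) \<and> \<Delta> \<subseteq> \<Delta>' \<and> decides \<Delta>' \<psi>"
proof -
  obtain k where k: "closed_at k k \<psi>" using closed_at_ex by blast
  define N where "N = max n k"
  have "closed_at N N \<psi>" by (rule closed_at_mono[OF k]) (auto simp: N_def)
  moreover have "closed_at N N \<chi>" if "\<chi> \<in> \<Delta>" for \<chi>
    by (rule closed_at_mono[OF cl[OF that]]) (auto simp: N_def)
  ultimately have N: "closed_at N N \<psi>" "\<And>\<chi>. \<chi> \<in> \<Delta> \<Longrightarrow> closed_at N N \<chi>" by blast+
  show ?thesis
  proof (cases "consistent (insert \<psi> \<Delta>)")
    case True
    then show ?thesis using N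
      by (intro exI[of _ "insert \<psi> \<Delta>"] exI[of _ N]) (auto simp: decides_def)
  next
    case False
    let ?D = "insert (Neg \<psi>) \<Delta>"
    have conD: "consistent ?D"
      using False con by (meson derives.Contr derives.ImpE derives.ImpI)
    have clD: "\<And>\<chi>. \<chi> \<in> ?D \<Longrightarrow> closed_at N N \<chi>" using N by auto
    have clD': "closed_at (Suc N) (Suc N) \<chi>" if "\<chi> \<in> ?D" for \<chi>
      using clD[OF that] by (rule closed_at_mono) auto
    have notD: "\<not> ?D \<turnstile> \<psi>"
      using conD derives.ImpE[OF derives.Assm[of "Neg \<psi>" ?D]] by auto
    have sep: "consistent (insert (Neg \<chi>) ?D)" if "\<not> ?D \<turnstile> \<chi>" for \<chi>
      using that derives.Contr by blast
    consider (N) \<chi> where "\<psi> = AllN \<chi>" | (S) \<chi> where "\<psi> = AllS \<chi>"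
      | (O) "\<And>\<chi>. \<psi> \<noteq> AllN \<chi>" "\<And>\<chi>. \<psi> \<noteq> AllS \<chi>" by (cases \<psi>) auto
    then show ?thesis
    proof cases
      case N
      have cl\<chi>: "closed_at (Suc N) N \<chi>" using \<open>closed_at N N \<psi>\<close> N by simp
      have "\<not> ?D \<turnstile> ninst (Var N) \<chi>"
        using AllN_fresh[OF clD cl\<chi>] notD N by blast
      moreover have "closed_at (Suc N) (Suc N) (ninst (Var N) \<chi>)"
        by (rule closed_at_nsub[OF closed_at_mono[OF cl\<chi>]]) (auto split: nat.split)
      ultimately show ?thesis using sep clD' N
        by (intro exI[of _ "insert (Neg (ninst (Var N) \<chi>)) ?D"] exI[of _ "Suc N"])
          (auto simp: decides_def)
    next
      case S
      have cl\<chi>: "closed_at N (Suc N) \<chi>" using \<open>closed_at N N \<psi>\<close> S by simp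
      have "\<not> ?D \<turnstile> sinst N \<chi>"
        using AllS_fresh[OF clD cl\<chi>] notD S by blast
      moreover have "closed_at (Suc N) (Suc N) (sinst N \<chi>)"
        by (rule closed_at_sren[OF closed_at_mono[OF cl\<chi>]]) (auto split: nat.split)
      ultimately show ?thesis using sep clD' S
        by (intro exI[of _ "insert (Neg (sinst N \<chi>)) ?D"] exI[of _ "Suc N"])
          (auto simp: decides_def)
    next
      case O
      then show ?thesis using conD clD
        by (intro exI[of _ ?D] exI[of _ N]) (auto simp: decides_def)
    qed
  qed
qed

lemma henkin_extension:
  assumes con: "consistent \<Delta>\<^sub>0" and cl: "\<And>\<psi>. \<psi> \<in> \<Delta>\<^sub>0 \<Longrightarrow> closed_at 0 0 \<psi>"
  obtains \<Delta> where "\<Delta>\<^sub>0 \<subseteq> \<Delta>" "consistent \<Delta>" "\<forall>\<psi>. decides \<Delta> \<psi>"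
proof -
  let ?P = "\<lambda>k (p :: fm set \<times> nat). consistent (fst p) \<and> (\<forall>\<psi>\<in>fst p. closed_at (snd p) (snd p) \<psi>)
     \<and> \<Delta>\<^sub>0 \<subseteq> fst p"
  let ?Q = "\<lambda>k (p :: fm set \<times> nat) (q :: fm set \<times> nat).
     fst p \<subseteq> fst q \<and> decides (fst q) (from_nat k)"
  have "\<exists>f. \<forall>k. ?P k (f k) \<and> ?Q k (f k) (f (Suc k))"
  proof (rule dependent_nat_choice)
    show "\<exists>p. ?P 0 p" using con cl by (intro exI[of _ "(\<Delta>\<^sub>0, 0)"]) auto
    show "\<exists>q. ?P (Suc k) q \<and> ?Q k p q" if "?P k p" for k p
    proof -
      from that decide_step[of "fst p" "snd p" "from_nat k"] obtain \<Delta>' n'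
        where "consistent \<Delta>'" "\<forall>\<psi>\<in>\<Delta>'. closed_at n' n' \<psi>" "fst p \<subseteq> \<Delta>'" "decides \<Delta>' (from_nat k)"
        by blast
      then show ?thesis using that by (intro exI[of _ "(\<Delta>', n')"]) auto
    qed
  qed
  then obtain f where f: "\<And>k. ?P k (f k)" "\<And>k. ?Q k (f k) (f (Suc k))" by blast
  define D where "D = (\<Union>k. fst (f k))"
  have mono: "fst (f i) \<subseteq> fst (f j)" if "i \<le> j" for i j
    using f(2) by (intro lift_Suc_mono_le[OF _ that]) auto
  have fin: "\<exists>k. F \<subseteq> fst (f k)" if "finite F" "F \<subseteq> D" for F
    using that
  proof (induction F rule: finite_induct)
    case (insert x F)
    then obtain k j where "F \<subseteq> fst (f k)" "x \<in> fst (f j)" by (auto simp: D_def)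
    then show ?case using mono[of k "max j k"] mono[of j "max j k"]
      by (intro exI[of _ "max j k"]) auto
  qed auto
  have "consistent D"
  proof
    assume "D \<turnstile> Falsum"
    then obtain F where "finite F" "F \<subseteq> D" "F \<turnstile> Falsum" using derives_finite by blast
    then show False using fin f(1) derives_mono by meson
  qed
  moreover have "\<forall>\<psi>. decides D \<psi>"
  proof
    fix \<psi>
    have "decides (fst (f (Suc (to_nat \<psi>)))) \<psi>" using f(2)[of "to_nat \<psi>"] by simp
    moreover have "fst (f (Suc (to_nat \<psi>))) \<subseteq> D" by (auto simp: D_def)
    ultimately show "decides D \<psi>" unfolding decides_def by blast
  qed
  moreover have "\<Delta>\<^sub>0 \<subseteq> D" using f(1)[of 0] by (auto simp: D_def)
  ultimately show ?thesis using that[of D] by simp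
qed


section \<open>Structures\<close>

text \<open>
  Structures for two-sorted logic. The sort of numbers is the type \<open>'a\<close>, that of sets is \<open>'s\<close>; set
  objects need not be extensional. Equality is a parameter, because in the term model it is
  provable equality.
\<close>

locale l2_structure =
  fixes zero one :: 'a and add mul :: "'a \<Rightarrow> 'a \<Rightarrow> 'a" and less eq :: "'a \<Rightarrow> 'a \<Rightarrow> bool"
    and mem :: "'a \<Rightarrow> 's \<Rightarrow> bool"
begin

primrec ev :: "(nat \<Rightarrow> 'a) \<Rightarrow> tm \<Rightarrow> 'a" where
  "ev e (Var i) = e i"
| "ev e NZero = zero"
| "ev e NOne = one"
| "ev e (Add s t) = add (ev e s) (ev e t)"
| "ev e (Mul s t) = mul (ev e s) (ev e t)"

primrec sat :: "(nat \<Rightarrow> 'a) \<Rightarrow> (nat \<Rightarrow> 's) \<Rightarrow> fm \<Rightarrow> bool" where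
  "sat e S (Eq s t) = eq (ev e s) (ev e t)"
| "sat e S (Less s t) = less (ev e s) (ev e t)"
| "sat e S (Mem t X) = mem (ev e t) (S X)"
| "sat e S Falsum = False"
| "sat e S (Imp \<phi> \<psi>) = (sat e S \<phi> \<longrightarrow> sat e S \<psi>)"
| "sat e S (AllN \<phi>) = (\<forall>x. sat (case_nat x e) S \<phi>)"
| "sat e S (AllS \<phi>) = (\<forall>X. sat e (case_nat X S) \<phi>)"

lemma ev_tsub: "ev e (tsub \<sigma> t) = ev (\<lambda>i. ev e (\<sigma> i)) t"
  by (induction t) auto

lemma sat_nsub: "sat e S (nsub \<sigma> \<phi>) = sat (\<lambda>i. ev e (\<sigma> i)) S \<phi>"
proof (induction \<phi> arbitrary: e S \<sigma>)
  case (AllN \<phi>)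
  have "(\<lambda>i. ev (case_nat x e) (up \<sigma> i)) = case_nat x (\<lambda>i. ev e (\<sigma> i))" for x
    by (rule ext) (auto simp: ev_tsub split: nat.split)
  then show ?case by (simp add: AllN)
qed (auto simp: ev_tsub)

lemma sat_sren: "sat e S (sren \<rho> \<phi>) = sat e (\<lambda>i. S (\<rho> i)) \<phi>"
proof (induction \<phi> arbitrary: e S \<rho>)
  case (AllS \<phi>)
  have "(\<lambda>i. case_nat X S (sup_ren \<rho> i)) = case_nat X (\<lambda>i. S (\<rho> i))" for X
    by (rule ext) (auto split: nat.split)
  then show ?case by (simp add: AllS)
qed auto

lemma sat_AllN_pow: "sat e S ((AllN ^^ n) \<phi>) \<Longrightarrow> sat (\<lambda>i. if i < n then e' i else e (i - n)) S \<phi>"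
proof (induction n arbitrary: e)
  case (Suc n)
  have "sat (case_nat (e' n) e) S ((AllN ^^ n) \<phi>)" using Suc.prems by simp
  from Suc.IH[OF this]
  have "sat (\<lambda>i. if i < n then e' i else case_nat (e' n) e (i - n)) S \<phi>" .
  moreover have "(\<lambda>i. if i < n then e' i else case_nat (e' n) e (i - n))
     = (\<lambda>i. if i < Suc n then e' i else e (i - Suc n))"
  proof (rule ext, goal_cases)
    case (1 i)
    consider "i < n" | "i = n" | j where "i = Suc (n + j)"
      by (metis less_iff_Suc_add linorder_neqE_nat)
    then show ?case by cases (auto simp: Suc_diff_le)
  qed
  ultimately show ?case by simp
qed auto

lemma sat_AllS_pow: "sat e S ((AllS ^^ n) \<phi>) \<Longrightarrow> sat e (\<lambda>i. if i < n then S' i else S (i - n)) \<phi>"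
proof (induction n arbitrary: S)
  case (Suc n)
  have "sat e (case_nat (S' n) S) ((AllS ^^ n) \<phi>)" using Suc.prems by simp
  from Suc.IH[OF this]
  have "sat e (\<lambda>i. if i < n then S' i else case_nat (S' n) S (i - n)) \<phi>" .
  moreover have "(\<lambda>i. if i < n then S' i else case_nat (S' n) S (i - n))
     = (\<lambda>i. if i < Suc n then S' i else S (i - Suc n))"
  proof (rule ext, goal_cases)
    case (1 i)
    consider "i < n" | "i = n" | j where "i = Suc (n + j)"
      by (metis less_iff_Suc_add linorder_neqE_nat)
    then show ?case by cases (auto simp: Suc_diff_le)
  qed
  ultimately show ?case by simp
qed auto

text \<open>
  A formula holds under all assignments if its universal closures do: a closure that binds the first
  \<open>k\<close> variables of each sort is instantiated with the first \<open>k\<close> values of \<open>e\<close> and \<open>S\<close>, under the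
  assignment that consists of the remaining values.
\<close>

lemma sat_univ_closures:
  assumes "\<And>\<psi> e S. \<psi> \<in> univ_closures \<phi> \<Longrightarrow> sat e S \<psi>"
  shows "sat e S \<phi>"
proof -
  obtain k where "closed_at k k \<phi>" using closed_at_ex by blast
  then have "(AllS ^^ k) ((AllN ^^ k) \<phi>) \<in> univ_closures \<phi>" by (auto simp: univ_closures_def)
  from assms[OF this, of "\<lambda>i. e (i + k)" "\<lambda>i. S (i + k)"]
  have "sat (\<lambda>i. e (i + k)) (\<lambda>i. if i < k then S i else S (i - k + k)) ((AllN ^^ k) \<phi>)"
    by (rule sat_AllS_pow)
  from sat_AllN_pow[OF this, of e]
  have "sat (\<lambda>i. if i < k then e i else e (i - k + k))
     (\<lambda>i. if i < k then S i else S (i - k + k)) \<phi>" .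
  moreover have "(\<lambda>i. if i < k then e i else e (i - k + k)) = e" by auto
  moreover have "(\<lambda>i. if i < k then S i else S (i - k + k)) = S" by auto
  ultimately show ?thesis by simp
qed

lemma semiring_axioms_sat:
  assumes "\<forall>\<psi>\<in>semiring_axioms. \<forall>e. sat e S \<psi>"
  shows "eq (add (add x y) z) (add x (add y z)) \<and> eq (add x y) (add y x) \<and> eq (add x zero) x
    \<and> (less x y \<longrightarrow> less y z \<longrightarrow> less x z) \<and> \<not> less x x \<and> (less x y \<or> eq x y \<or> less y x)
    \<and> (less x y \<longrightarrow> less (add x z) (add y z)) \<and> (less x y \<longrightarrow> (\<exists>u. eq (add x u) y))
    \<and> less zero one \<and> (less zero x \<longrightarrow> eq one x \<or> less one x) \<and> (eq zero x \<or> less zero x)"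
proof -
  have "\<forall>\<psi>\<in>semiring_axioms. sat (case_nat x (case_nat y (\<lambda>_. z))) S \<psi>" using assms by blast
  then show ?thesis
    unfolding semiring_axioms_def Let_def
    by (simp only: ball_simps numeral_2_eq_2 sat.simps ev.simps nat.case One_nat_def tsub.simps
        simp_thms not_all not_imp) argo
qed

end

lemma sat_surjective_hom:
  fixes h :: "'a \<Rightarrow> 'b" and zero one :: 'a and zero' one' :: 'b and add mul :: "'a \<Rightarrow> 'a \<Rightarrow> 'a"
    and add' mul' :: "'b \<Rightarrow> 'b \<Rightarrow> 'b" and less eq :: "'a \<Rightarrow> 'a \<Rightarrow> bool"
    and less' eq' :: "'b \<Rightarrow> 'b \<Rightarrow> bool" and mem :: "'a \<Rightarrow> 's \<Rightarrow> bool" and mem' :: "'b \<Rightarrow> 's \<Rightarrow> bool"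
  assumes "h zero = zero'" "h one = one'" "\<And>x y. h (add x y) = add' (h x) (h y)"
    "\<And>x y. h (mul x y) = mul' (h x) (h y)" "\<And>x y. less x y = less' (h x) (h y)"
    "\<And>x y. eq x y = eq' (h x) (h y)" "\<And>x X. mem x X = mem' (h x) X" and surj: "surj h"
  shows "l2_structure.sat zero one add mul less eq mem e S \<phi>
     = l2_structure.sat zero' one' add' mul' less' eq' mem' (\<lambda>i. h (e i)) S \<phi>"
proof -
  interpret A: l2_structure zero one add mul less eq mem .
  interpret B: l2_structure zero' one' add' mul' less' eq' mem' .
  have ev: "h (A.ev e t) = B.ev (\<lambda>i. h (e i)) t" for e t
    by (induction t) (auto simp: assms)
  show ?thesis
  proof (induction \<phi> arbitrary: e S)
    case (AllN \<phi>)
    have "(\<lambda>i. h (case_nat x e i)) = case_nat (h x) (\<lambda>i. h (e i))" for x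
      by (rule ext) (auto split: nat.split)
    then show ?case using surj by (auto simp: AllN) (metis surj_def)
  qed (auto simp: assms ev)
qed


section \<open>The completeness theorem\<close>

text \<open>
  The term model of a consistent set that decides all formulas: its numbers are terms, and its sets
  are set variables.
\<close>

locale henkin =
  fixes \<Delta> :: "fm set"
  assumes con: "consistent \<Delta>" and dec: "\<And>\<psi>. decides \<Delta> \<psi>"
begin

sublocale T: l2_structure NZero NOne Add Mul "\<lambda>s t. Less s t \<in> \<Delta>" "\<lambda>s t. Eq s t \<in> \<Delta>"
  "\<lambda>t X. Mem t X \<in> \<Delta>" .

lemma theory_iff: "\<Delta> \<turnstile> \<phi> \<longleftrightarrow> \<phi> \<in> \<Delta>"
  using con dec[of \<phi>] unfolding decides_def by (meson derives.Assm derives.ImpE)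

lemma Falsum_iff: "Falsum \<notin> \<Delta>"
  using con theory_iff by blast

lemma Imp_iff: "Imp \<phi> \<psi> \<in> \<Delta> \<longleftrightarrow> (\<phi> \<in> \<Delta> \<longrightarrow> \<psi> \<in> \<Delta>)"
proof -
  have "Imp \<phi> \<psi> \<in> \<Delta>" if "\<phi> \<notin> \<Delta>"
  proof -
    have "Neg \<phi> \<in> \<Delta>" using that dec[of \<phi>] by (auto simp: decides_def)
    then have "insert \<phi> \<Delta> \<turnstile> Falsum" by (meson derives.Assm derives.ImpE insertI1 insertI2)
    then have "insert \<phi> \<Delta> \<turnstile> \<psi>" by (meson derives.Contr derives_mono subset_insertI)
    then show ?thesis using theory_iff derives.ImpI by blast
  qed
  moreover have "Imp \<phi> \<psi> \<in> \<Delta>" if "\<psi> \<in> \<Delta>"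
    using that theory_iff by (meson derives.Assm derives.ImpI insertI2)
  ultimately show ?thesis by (meson theory_iff derives.Assm derives.ImpE)
qed

lemma AllN_iff: "AllN \<chi> \<in> \<Delta> \<longleftrightarrow> (\<forall>t. ninst t \<chi> \<in> \<Delta>)"
proof
  show "AllN \<chi> \<in> \<Delta> \<Longrightarrow> \<forall>t. ninst t \<chi> \<in> \<Delta>"
    unfolding theory_iff[symmetric] by (intro allI derives.AllNE)
  show "\<forall>t. ninst t \<chi> \<in> \<Delta> \<Longrightarrow> AllN \<chi> \<in> \<Delta>"
    using dec[of "AllN \<chi>"] Imp_iff Falsum_iff by (auto simp: decides_def)
qed

lemma AllS_iff: "AllS \<chi> \<in> \<Delta> \<longleftrightarrow> (\<forall>X. sinst X \<chi> \<in> \<Delta>)"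
proof
  show "AllS \<chi> \<in> \<Delta> \<Longrightarrow> \<forall>X. sinst X \<chi> \<in> \<Delta>"
    unfolding theory_iff[symmetric] by (intro allI derives.AllSE)
  show "\<forall>X. sinst X \<chi> \<in> \<Delta> \<Longrightarrow> AllS \<chi> \<in> \<Delta>"
    using dec[of "AllS \<chi>"] Imp_iff Falsum_iff by (auto simp: decides_def)
qed

lemma ev_term_model: "T.ev \<sigma> t = tsub \<sigma> t"
  by (induction t) auto

lemma truth: "T.sat \<sigma> \<rho> \<phi> \<longleftrightarrow> nsub \<sigma> (sren \<rho> \<phi>) \<in> \<Delta>"
proof (induction \<phi> arbitrary: \<sigma> \<rho>)
  case (AllN \<phi>)
  have "(\<lambda>i. tsub (case_nat t Var) (up \<sigma> i)) = case_nat t \<sigma>" for t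
    by (rule ext) (auto simp: tsub_tsub split: nat.split)
  then have "ninst t (nsub (up \<sigma>) \<psi>) = nsub (case_nat t \<sigma>) \<psi>" for t \<psi>
    by (simp add: nsub_nsub)
  then show ?case using AllN by (simp add: AllN_iff)
next
  case (AllS \<phi>)
  have "(\<lambda>i. case_nat X (\<lambda>i. i) (sup_ren \<rho> i)) = case_nat X \<rho>" for X
    by (rule ext) (auto split: nat.split)
  then have "sinst X (sren (sup_ren \<rho>) \<psi>) = sren (case_nat X \<rho>) \<psi>" for X \<psi>
    by (simp add: sren_sren)
  then show ?case using AllS by (simp add: AllS_iff nsub_sren[symmetric])
qed (auto simp: Imp_iff Falsum_iff ev_term_model)

lemma truth_sentence: "closed_at 0 0 \<phi> \<Longrightarrow> T.sat \<sigma> \<rho> \<phi> \<longleftrightarrow> \<phi> \<in> \<Delta>"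
  by (simp add: truth sentence_sren[of 0] sentence_nsub[of 0])

lemma eq_refl: "Eq t t \<in> \<Delta>"
  using derives.EqRefl theory_iff by blast

lemma eq_subst: "Eq s t \<in> \<Delta> \<Longrightarrow> ninst s \<phi> \<in> \<Delta> \<Longrightarrow> ninst t \<phi> \<in> \<Delta>"
  using derives.EqSubst theory_iff by blast

lemma ninst_tlift [simp]: "tsub (case_nat t Var) (tlift u) = u"
  by (simp add: tsub_tsub)

lemma eq_sym: "Eq s t \<in> \<Delta> \<Longrightarrow> Eq t s \<in> \<Delta>"
  using eq_subst[of s t "Eq (Var 0) (tlift s)"] eq_refl by simp

lemma eq_trans: "Eq s t \<in> \<Delta> \<Longrightarrow> Eq t u \<in> \<Delta> \<Longrightarrow> Eq s u \<in> \<Delta>"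
  using eq_subst[of t u "Eq (tlift s) (Var 0)"] by simp

lemma eq_Add: "Eq s s' \<in> \<Delta> \<Longrightarrow> Eq t t' \<in> \<Delta> \<Longrightarrow> Eq (Add s t) (Add s' t') \<in> \<Delta>"
  using eq_subst[of s s' "Eq (Add (tlift s) (tlift t)) (Add (Var 0) (tlift t))"]
    eq_subst[of t t' "Eq (Add (tlift s) (tlift t)) (Add (tlift s') (Var 0))"] eq_refl by simp

lemma eq_Mul: "Eq s s' \<in> \<Delta> \<Longrightarrow> Eq t t' \<in> \<Delta> \<Longrightarrow> Eq (Mul s t) (Mul s' t') \<in> \<Delta>"
  using eq_subst[of s s' "Eq (Mul (tlift s) (tlift t)) (Mul (Var 0) (tlift t))"]
    eq_subst[of t t' "Eq (Mul (tlift s) (tlift t)) (Mul (tlift s') (Var 0))"] eq_refl by simp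

lemma eq_Less: "Eq s s' \<in> \<Delta> \<Longrightarrow> Eq t t' \<in> \<Delta> \<Longrightarrow> Less s t \<in> \<Delta> \<Longrightarrow> Less s' t' \<in> \<Delta>"
  using eq_subst[of s s' "Less (Var 0) (tlift t)"] eq_subst[of t t' "Less (tlift s') (Var 0)"]
  by simp

lemma eq_Mem: "Eq s s' \<in> \<Delta> \<Longrightarrow> Mem s X \<in> \<Delta> \<Longrightarrow> Mem s' X \<in> \<Delta>"
  using eq_subst[of s s' "Mem (Var 0) X"] by simp

text \<open>
  The quotient of the term model by provable equality is countable, and infinite as soon as the
  model has a strictly increasing sequence. Its numbers can therefore be taken to be the whole type
  of natural numbers, which spares the use of carrier sets.
\<close>

lemma quotient_structure:
  assumes inf: "\<And>k. Less (num k) (num (Suc k)) \<in> \<Delta>"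
    and tr: "\<forall>s t u. Less s t \<in> \<Delta> \<longrightarrow> Less t u \<in> \<Delta> \<longrightarrow> Less s u \<in> \<Delta>"
    and irr: "\<And>t. Less t t \<notin> \<Delta>"
  shows "\<exists>(h :: tm \<Rightarrow> nat) zero one add mul less (mem :: nat \<Rightarrow> nat \<Rightarrow> bool). surj h \<and>
    (\<forall>e S \<phi>. T.sat e S \<phi> = l2_structure.sat zero one add mul less (=) mem (\<lambda>i. h (e i)) S \<phi>)"
proof -
  define E where "E = {(s, t). Eq s t \<in> \<Delta>}"
  have E: "equiv UNIV E"
    by (rule equivI) (auto simp: E_def refl_on_def sym_def trans_def eq_refl intro: eq_sym eq_trans)
  have less: "Less (num j) (num k) \<in> \<Delta>" if "j < k" for j k
    using that by (induction rule: strict_inc_induct) (use inf tr in blast)+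
  have "inj (\<lambda>k. E `` {num k})"
  proof (rule linorder_injI)
    fix j k :: nat assume "j < k"
    then have "Eq (num k) (num j) \<notin> \<Delta>" using less eq_Less[OF eq_refl] irr by blast
    then show "E `` {num j} \<noteq> E `` {num k}"
      using eq_equiv_class[OF _ E, of "num k" "num j"] by (auto simp: E_def)
  qed
  moreover have "range (\<lambda>k. E `` {num k}) \<subseteq> UNIV // E" by (auto intro: quotientI)
  ultimately have "infinite (UNIV // E)"
    using finite_imageD finite_subset infinite_UNIV_nat by metis
  moreover have "UNIV // E = range (\<lambda>t. E `` {t})" by (auto simp: quotient_def)
  then have "countable (UNIV // E)" by simp
  ultimately obtain b :: "tm set \<Rightarrow> nat" where b: "bij_betw b (UNIV // E) UNIV"
    using countableE_infinite by blast
  define h where "h = (\<lambda>t. b (E `` {t}))"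
  have h: "h s = h t \<longleftrightarrow> Eq s t \<in> \<Delta>" for s t
  proof -
    have "h s = h t \<longleftrightarrow> E `` {s} = E `` {t}" unfolding h_def
      by (rule inj_on_eq_iff[OF bij_betw_imp_inj_on[OF b]]) (auto intro: quotientI)
    then show ?thesis using eq_equiv_class_iff[OF E, of s t] by (simp add: E_def)
  qed
  have surj: "surj h"
    using b unfolding h_def bij_betw_def quotient_def by (auto simp: surj_def image_iff)
  define g where "g = inv h"
  have g: "Eq (g (h t)) t \<in> \<Delta>" for t
    using h[of "g (h t)" t] surj_f_inv_f[OF surj, of "h t"] by (simp add: g_def)
  note g' = eq_sym[OF g]
  have "T.sat e S \<phi> = l2_structure.sat (h NZero) (h NOne) (\<lambda>x y. h (Add (g x) (g y)))
    (\<lambda>x y. h (Mul (g x) (g y))) (\<lambda>x y. Less (g x) (g y) \<in> \<Delta>) (=)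
    (\<lambda>x X. Mem (g x) X \<in> \<Delta>) (\<lambda>i. h (e i)) S \<phi>" for e S \<phi>
  proof (rule sat_surjective_hom)
    show "h (Add x y) = h (Add (g (h x)) (g (h y)))" for x y
      unfolding h by (rule eq_Add[OF g' g'])
    show "h (Mul x y) = h (Mul (g (h x)) (g (h y)))" for x y
      unfolding h by (rule eq_Mul[OF g' g'])
    show "(Less x y \<in> \<Delta>) = (Less (g (h x)) (g (h y)) \<in> \<Delta>)" for x y
      using eq_Less[OF g g] eq_Less[OF g' g'] by blast
    show "(Mem x X \<in> \<Delta>) = (Mem (g (h x)) X \<in> \<Delta>)" for x X
      using eq_Mem[OF g] eq_Mem[OF g'] by blast
  qed (simp_all add: h surj)
  then show ?thesis using surj by blast
qed

end

text \<open>
  Completeness for theories of arithmetic: the order axioms make the term model infinite, so that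
  structures on the type of natural numbers, with arbitrary operations, suffice. As both \<open>\<Gamma>\<close> and
  \<open>\<phi>\<close> consist of sentences, all variables are available as Henkin constants.
\<close>

theorem completeness:
  assumes cl: "\<And>\<psi>. \<psi> \<in> \<Gamma> \<Longrightarrow> closed_at 0 0 \<psi>" and cl\<phi>: "closed_at 0 0 \<phi>"
    and ax: "(\<Union>\<psi>\<in>semiring_axioms. univ_closures \<psi>) \<subseteq> \<Gamma>"
    and valid: "\<And>(zero :: nat) one add mul less (mem :: nat \<Rightarrow> nat \<Rightarrow> bool) e S.
       (\<And>\<psi> e S. \<psi> \<in> \<Gamma> \<Longrightarrow> l2_structure.sat zero one add mul less (=) mem e S \<psi>) \<Longrightarrow>
       l2_structure.sat zero one add mul less (=) mem e S \<phi>"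
  shows "\<Gamma> \<turnstile> \<phi>"
proof (rule ccontr)
  assume "\<not> \<Gamma> \<turnstile> \<phi>"
  then have con: "consistent (insert (Neg \<phi>) \<Gamma>)" using derives.Contr by blast
  have cl': "closed_at 0 0 \<psi>" if "\<psi> \<in> insert (Neg \<phi>) \<Gamma>" for \<psi>
    using that cl cl\<phi> by auto
  obtain \<Delta>
    where \<Delta>: "insert (Neg \<phi>) \<Gamma> \<subseteq> \<Delta>" "consistent \<Delta>" "\<forall>\<psi>. decides \<Delta> \<psi>"
    by (rule henkin_extension[OF con cl'])
  interpret henkin \<Delta> by standard (use \<Delta> in auto)
  have sat\<Gamma>: "T.sat e S \<psi>" if "\<psi> \<in> \<Gamma>" for \<psi> e S
    using that truth_sentence[OF cl[OF that]] \<Delta>(1) by auto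
  have open_ax: "\<forall>\<psi>\<in>semiring_axioms. \<forall>e. T.sat e S \<psi>" for S
    using ax by (intro ballI allI, rule_tac T.sat_univ_closures, rule_tac sat\<Gamma>) auto
  define num where "num = rec_nat NZero (\<lambda>_ t. Add NOne t)"
  note ax_sat = T.semiring_axioms_sat[OF open_ax]
  have tr: "\<forall>s t u. Less s t \<in> \<Delta> \<longrightarrow> Less t u \<in> \<Delta> \<longrightarrow> Less s u \<in> \<Delta>"
  proof (intro allI)
    show "Less s t \<in> \<Delta> \<longrightarrow> Less t u \<in> \<Delta> \<longrightarrow> Less s u \<in> \<Delta>" for s t u
      using ax_sat[of s t u] by argo
  qed
  have irr: "Less t t \<notin> \<Delta>" for t
    using ax_sat[of t t t] by argo
  have step: "Less (num k) (num (Suc k)) \<in> \<Delta>" for k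
  proof -
    have 1: "Less (Add NZero (num k)) (Add NOne (num k)) \<in> \<Delta>"
      using ax_sat[of NZero NOne "num k"] by argo
    have "Eq (Add NZero (num k)) (num k) \<in> \<Delta>"
      using ax_sat[of NZero "num k" NZero] ax_sat[of "num k" NZero NZero]
      by (intro eq_trans[of "Add NZero (num k)" "Add (num k) NZero" "num k"]) argo+
    then show ?thesis using eq_Less[OF _ eq_refl 1] by (simp add: num_def)
  qed
  from quotient_structure[of num, OF step tr irr]
  obtain h :: "tm \<Rightarrow> nat" and zero one add mul less and mem :: "nat \<Rightarrow> nat \<Rightarrow> bool" where surj: "surj h" and h:
    "\<And>e S \<phi>. T.sat e S \<phi> = l2_structure.sat zero one add mul less (=) mem (\<lambda>i. h (e i)) S \<phi>"
    by (elim exE conjE) blast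
  have "l2_structure.sat zero one add mul less (=) mem e S \<psi>" if "\<psi> \<in> \<Gamma>" for \<psi> e S
    using sat\<Gamma>[OF that, of "\<lambda>i. inv h (e i)" S] unfolding h surj_f_inv_f[OF surj] .
  from valid[OF this] have "T.sat Var (\<lambda>i. i) \<phi>" unfolding h by simp
  then have "\<phi> \<in> \<Delta>" using truth_sentence[OF cl\<phi>] by blast
  then show False using \<Delta>(1,2) Imp_iff Falsum_iff by blast
qed


section \<open>Definable sets in models of \<open>\<Pi>\<^sup>1\<^sub>1\<close> comprehension\<close>

lemma arithmetical_nsub [simp]: "arithmetical (nsub \<sigma> \<phi>) = arithmetical \<phi>"
  by (induction \<phi> arbitrary: \<sigma>) auto

lemma arithmetical_sren [simp]: "arithmetical (sren \<rho> \<phi>) = arithmetical \<phi>"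
  by (induction \<phi> arbitrary: \<rho>) auto

text \<open>
  The models: structures with equality as identity that satisfy the arithmetical axioms, \<open>\<Sigma>\<^sup>0\<^sub>1\<close> induction
  and \<open>\<Pi>\<^sup>1\<^sub>1\<close> comprehension.
\<close>

locale pi11_model = l2_structure zero one add mul less "(=)" mem
  for zero one :: 'a and add mul and less (infix "\<prec>" 50) and mem :: "'a \<Rightarrow> 's \<Rightarrow> bool" +
  assumes semiring_sat: "\<forall>\<psi>\<in>semiring_axioms. \<forall>e. sat e S \<psi>"
    and induction_sat: "sigma01 \<phi> \<Longrightarrow> sat e S (induction_ax \<phi>)"
    and comprehension_sat: "pi11 \<phi> \<Longrightarrow> sat e S (comprehension_ax \<phi>)"
begin

text \<open>
  The set of numbers that a set object represents.
\<close>

definition ext :: "'s \<Rightarrow> 'a set" where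
  "ext X = {x. mem x X}"

text \<open>
  A coded set is one that belongs to the structure.
\<close>

definition coded :: "'a set \<Rightarrow> bool" where
  "coded Q \<longleftrightarrow> Q \<in> range ext"

text \<open>
  The possible values of a free number variable of a formula: an entry of the environment, or a
  fixed parameter.
\<close>

definition slot :: "((nat \<Rightarrow> 'a) \<Rightarrow> 'a) \<Rightarrow> bool" where
  "slot t \<longleftrightarrow> (\<exists>j. t = (\<lambda>e. e j)) \<or> (\<exists>a. t = (\<lambda>e. a))"

text \<open>
  The conditions \<open>F e Y\<close> on an environment \<open>e\<close> of numbers and a set \<open>Y\<close> that are given by an
  arithmetical formula with number and set parameters. The distinguished set \<open>Y\<close> is set variable 0
  of the formula, and only coded values of \<open>Y\<close> matter. Entries of \<open>e\<close> act as de Bruijn indices, as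
  the quantifier rules \<open>arith_all\<close> and \<open>arith_ex\<close> show, so that arithmetical definability of a
  concrete condition is proved by applying \<open>arith_intros\<close> backwards.
\<close>

definition arith :: "((nat \<Rightarrow> 'a) \<Rightarrow> 'a set \<Rightarrow> bool) \<Rightarrow> bool" where
  "arith F \<longleftrightarrow> (\<exists>\<phi> \<sigma> S. arithmetical \<phi> \<and> (\<forall>i. slot (\<sigma> i))
     \<and> (\<forall>e Y. F e (ext Y) = sat (\<lambda>i. \<sigma> i e) (case_nat Y S) \<phi>))"

lemma arithI:
  assumes "arithmetical \<phi>" "\<And>i. slot (\<sigma> i)"
    "\<And>e Y. F e (ext Y) = sat (\<lambda>i. \<sigma> i e) (case_nat Y S) \<phi>"
  shows "arith F"
  unfolding arith_def using assms by blast

lemma arithE: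
  assumes "arith F"
  obtains \<phi> \<sigma> S where "arithmetical \<phi>" "\<forall>i. slot (\<sigma> i)"
    "\<forall>e Y. F e (ext Y) = sat (\<lambda>i. \<sigma> i e) (case_nat Y S) \<phi>"
  using assms unfolding arith_def by blast

lemma slot_var: "slot (\<lambda>e. e j)"
  by (auto simp: slot_def)

lemma slot_const: "slot (\<lambda>e. a)"
  by (auto simp: slot_def)

lemma slot_comp: "slot t \<Longrightarrow> (\<And>j. slot (\<tau> j)) \<Longrightarrow> slot (\<lambda>e. t (\<lambda>j. \<tau> j e))"
  by (auto simp: slot_def)

lemma arith_subst: "arith F \<Longrightarrow> (\<And>j. slot (\<tau> j)) \<Longrightarrow> arith (\<lambda>e Y. F (\<lambda>j. \<tau> j e) Y)"
proof -
  assume F: "arith F" and \<tau>: "\<And>j. slot (\<tau> j)"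
  obtain \<phi> \<sigma> S where \<phi>: "arithmetical \<phi>" "\<forall>i. slot (\<sigma> i)"
    "\<forall>e Y. F e (ext Y) = sat (\<lambda>i. \<sigma> i e) (case_nat Y S) \<phi>" using arithE[OF F] .
  show ?thesis
    by (rule arithI[of \<phi> "\<lambda>i e. \<sigma> i (\<lambda>j. \<tau> j e)" _ S]) (use \<phi> \<tau> slot_comp in auto)
qed

lemma arith_false: "arith (\<lambda>e Y. False)"
  by (rule arithI[of Falsum "\<lambda>_ e. zero"]) (auto intro: slot_const)

lemma arith_less: "slot t \<Longrightarrow> slot u \<Longrightarrow> arith (\<lambda>e Y. t e \<prec> u e)"
  by (rule arithI[of "Less (Var 0) (Var 1)" "case_nat t (\<lambda>_. u)"]) (auto split: nat.split)

lemma arith_eq: "slot t \<Longrightarrow> slot u \<Longrightarrow> arith (\<lambda>e Y. t e = u e)"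
  by (rule arithI[of "Eq (Var 0) (Var 1)" "case_nat t (\<lambda>_. u)"]) (auto split: nat.split)

lemma arith_mem_bound: "slot t \<Longrightarrow> arith (\<lambda>e Y. t e \<in> Y)"
  by (rule arithI[of "Mem (Var 0) 0" "\<lambda>_. t"]) (auto simp: ext_def)

lemma arith_mem: "coded Q \<Longrightarrow> slot t \<Longrightarrow> arith (\<lambda>e Y. t e \<in> Q)"
  unfolding coded_def by (auto simp: ext_def intro!: arithI[of "Mem (Var 0) 1" "\<lambda>_. t" _ "\<lambda>_. X" for X])

text \<open>
  The parameters of the two formulas are interleaved.
\<close>

lemma arith_imp:
  assumes F: "arith F" and G: "arith G"
  shows "arith (\<lambda>e Y. F e Y \<longrightarrow> G e Y)"
proof -
  obtain \<phi> \<sigma> S where \<phi>: "arithmetical \<phi>" "\<forall>i. slot (\<sigma> i)"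
    "\<forall>e Y. F e (ext Y) = sat (\<lambda>i. \<sigma> i e) (case_nat Y S) \<phi>" using arithE[OF F] .
  obtain \<psi> \<tau> U where \<psi>: "arithmetical \<psi>" "\<forall>i. slot (\<tau> i)"
    "\<forall>e Y. G e (ext Y) = sat (\<lambda>i. \<tau> i e) (case_nat Y U) \<psi>" using arithE[OF G] .
  define \<pi> where "\<pi> = (\<lambda>i. if even i then \<sigma> (i div 2) else \<tau> (i div 2))"
  define V where "V = (\<lambda>i :: nat. if even i then S (i div 2) else U (i div 2))"
  define \<phi>' where "\<phi>' = nsub (\<lambda>i. Var (2 * i)) (sren (case_nat 0 (\<lambda>i. Suc (2 * i))) \<phi>)"
  define \<psi>' where "\<psi>' = nsub (\<lambda>i. Var (Suc (2 * i))) (sren (case_nat 0 (\<lambda>i. Suc (Suc (2 * i)))) \<psi>)"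
  have 1: "(\<lambda>i. case_nat Y V (case_nat 0 (\<lambda>i. Suc (2 * i)) i)) = case_nat Y S" for Y
    by (rule ext) (auto simp: V_def split: nat.split)
  have 2: "(\<lambda>i. case_nat Y V (case_nat 0 (\<lambda>i. Suc (Suc (2 * i))) i)) = case_nat Y U" for Y
    by (rule ext) (auto simp: V_def split: nat.split)
  have "F e (ext Y) = sat (\<lambda>i. \<pi> i e) (case_nat Y V) \<phi>'" for e Y
    using \<phi>(3) 1[of Y] by (simp add: \<phi>'_def sat_nsub sat_sren \<pi>_def)
  moreover have "G e (ext Y) = sat (\<lambda>i. \<pi> i e) (case_nat Y V) \<psi>'" for e Y
    using \<psi>(3) 2[of Y] by (simp add: \<psi>'_def sat_nsub sat_sren \<pi>_def)
  ultimately show ?thesis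
    using \<phi>(1,2) \<psi>(1,2)
    by (intro arithI[of "Imp \<phi>' \<psi>'" \<pi> _ V]) (auto simp: \<phi>'_def \<psi>'_def \<pi>_def)
qed

text \<open>
  A representing formula can be chosen in which entry 0 of the environment is number variable 0 and
  no other variable depends on it.
\<close>

lemma arith_isolate:
  assumes F: "arith F"
  shows "\<exists>\<phi> \<sigma> S. arithmetical \<phi> \<and> (\<forall>i. slot (\<sigma> i))
    \<and> (\<forall>x e Y. F (case_nat x e) (ext Y) = sat (case_nat x (\<lambda>i. \<sigma> i e)) (case_nat Y S) \<phi>)"
proof -
  obtain \<phi> \<sigma> S where \<phi>: "arithmetical \<phi>" "\<forall>i. slot (\<sigma> i)"
    "\<forall>e Y. F e (ext Y) = sat (\<lambda>i. \<sigma> i e) (case_nat Y S) \<phi>" using arithE[OF F] .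
  have "\<exists>t. slot t \<and> (\<sigma> i \<noteq> (\<lambda>e. e 0) \<longrightarrow> (\<forall>x e. \<sigma> i (case_nat x e) = t e))" for i
  proof -
    consider (v) j where "\<sigma> i = (\<lambda>e. e j)" | (c) a where "\<sigma> i = (\<lambda>e. a)"
      using \<phi>(2) unfolding slot_def by blast
    then show ?thesis
    proof cases
      case v
      then show ?thesis
        by (intro exI[of _ "\<lambda>e. e (j - 1)"]) (cases j; auto intro: slot_var)
    next
      case c
      then show ?thesis by (intro exI[of _ "\<lambda>e. a"]) (auto intro: slot_const)
    qed
  qed
  then obtain \<tau> where \<tau>: "\<And>i. slot (\<tau> i)"
    "\<And>i x e. \<sigma> i \<noteq> (\<lambda>e. e 0) \<Longrightarrow> \<sigma> i (case_nat x e) = \<tau> i e" by metis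
  define \<nu> where "\<nu> = (\<lambda>i. if \<sigma> i = (\<lambda>e. e 0) then 0 else Suc i)"
  have "(\<lambda>i. case_nat x (\<lambda>i. \<tau> i e) (\<nu> i)) = (\<lambda>i. \<sigma> i (case_nat x e))" for x e
    by (rule ext) (auto simp: \<nu>_def \<tau>)
  then have "F (case_nat x e) (ext Y)
      = sat (case_nat x (\<lambda>i. \<tau> i e)) (case_nat Y S) (nsub (\<lambda>i. Var (\<nu> i)) \<phi>)" for x e Y
    using \<phi>(3) by (simp add: sat_nsub)
  then show ?thesis using \<tau>(1) \<phi>(1)
    by (intro exI[of _ "nsub (\<lambda>i. Var (\<nu> i)) \<phi>"] exI[of _ \<tau>] exI[of _ S]) auto
qed

lemma arith_all:
  assumes "arith (\<lambda>e Y. G (\<lambda>i. e (Suc i)) (e 0) Y)"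
  shows "arith (\<lambda>e Y. \<forall>x. G e x Y)"
proof -
  from arith_isolate[OF assms] obtain \<phi> \<sigma> S where "arithmetical \<phi>" "\<forall>i. slot (\<sigma> i)"
    "\<forall>x e Y. G e x (ext Y) = sat (case_nat x (\<lambda>i. \<sigma> i e)) (case_nat Y S) \<phi>"
    by auto
  then show ?thesis by (intro arithI[of "AllN \<phi>" \<sigma> _ S]) auto
qed

lemma arith_not: "arith F \<Longrightarrow> arith (\<lambda>e Y. \<not> F e Y)"
  using arith_imp[of F "\<lambda>_ _. False"] arith_false by simp

lemma arith_disj: "arith F \<Longrightarrow> arith G \<Longrightarrow> arith (\<lambda>e Y. F e Y \<or> G e Y)"
  using arith_imp[OF arith_not] by (simp add: imp_conv_disj)

lemma arith_conj: "arith F \<Longrightarrow> arith G \<Longrightarrow> arith (\<lambda>e Y. F e Y \<and> G e Y)"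
  using arith_not[OF arith_imp[OF _ arith_not]] by simp

lemma arith_ex: "arith (\<lambda>e Y. G (\<lambda>i. e (Suc i)) (e 0) Y) \<Longrightarrow> arith (\<lambda>e Y. \<exists>x. G e x Y)"
  using arith_not[OF arith_all[OF arith_not]] by simp

lemma arith_ball:
  "coded Q \<Longrightarrow> arith (\<lambda>e Y. G (\<lambda>i. e (Suc i)) (e 0) Y) \<Longrightarrow> arith (\<lambda>e Y. \<forall>x\<in>Q. G e x Y)"
  unfolding Ball_def by (intro arith_all arith_imp arith_mem slot_var)

lemma arith_bex:
  "coded Q \<Longrightarrow> arith (\<lambda>e Y. G (\<lambda>i. e (Suc i)) (e 0) Y) \<Longrightarrow> arith (\<lambda>e Y. \<exists>x\<in>Q. G e x Y)"
  unfolding Bex_def by (intro arith_ex arith_conj arith_mem slot_var)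

lemma arith_ball_bound:
  "arith (\<lambda>e Y. G (\<lambda>i. e (Suc i)) (e 0) Y) \<Longrightarrow> arith (\<lambda>e Y. \<forall>x\<in>Y. G e x Y)"
  unfolding Ball_def by (intro arith_all arith_imp arith_mem_bound slot_var)

lemma arith_bex_bound:
  "arith (\<lambda>e Y. G (\<lambda>i. e (Suc i)) (e 0) Y) \<Longrightarrow> arith (\<lambda>e Y. \<exists>x\<in>Y. G e x Y)"
  unfolding Bex_def by (intro arith_ex arith_conj arith_mem_bound slot_var)

lemma arith_const: "arith (\<lambda>e Y. P)"
  using arith_not[OF arith_false] arith_false by (cases P) auto

definition le :: "'a \<Rightarrow> 'a \<Rightarrow> bool" (infix "\<preceq>" 50) where
  "x \<preceq> y \<longleftrightarrow> x \<prec> y \<or> x = y"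

lemma arith_le: "slot t \<Longrightarrow> slot u \<Longrightarrow> arith (\<lambda>e Y. t e \<preceq> u e)"
  unfolding le_def by (intro arith_disj arith_less arith_eq)

lemmas arith_intros = arith_false arith_not arith_disj arith_conj arith_imp arith_all arith_ex arith_ball arith_bex arith_ball_bound
  arith_bex_bound arith_less arith_eq arith_le arith_mem arith_mem_bound slot_var slot_const

text \<open>
  Arithmetically definable binary relations.
\<close>

definition arith2 :: "('a \<Rightarrow> 'a \<Rightarrow> bool) \<Rightarrow> bool" where
  "arith2 R \<longleftrightarrow> arith (\<lambda>e Y. R (e 0) (e (Suc 0)))"

lemma arith_arith2: "arith2 R \<Longrightarrow> slot t \<Longrightarrow> slot u \<Longrightarrow> arith (\<lambda>e Y. R (t e) (u e))"
  unfolding arith2_def using arith_subst[of "\<lambda>e Y. R (e 0) (e (Suc 0))" "case_nat t (\<lambda>_. u)"]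
  by (auto split: nat.split)

lemma arith2_converse: "arith2 R \<Longrightarrow> arith2 (\<lambda>x y. R y x)"
  unfolding arith2_def[of "\<lambda>x y. R y x"] by (intro arith_arith2 slot_var)

text \<open>
  Comprehension in its semantic form.
\<close>

theorem coded_pi11:
  assumes "arith (\<lambda>e Y. P (e 0) Y)"
  shows "coded {x. \<forall>X. coded X \<longrightarrow> P x X}"
proof -
  from arith_isolate[OF assms, unfolded nat.case] obtain \<phi> \<sigma> S where \<phi>: "arithmetical \<phi>"
    "\<forall>i. slot (\<sigma> i)" "\<forall>x e Y. P x (ext Y) = sat (case_nat x (\<lambda>i. \<sigma> i e)) (case_nat Y S) \<phi>"
    by blast
  have "pi11 (AllS \<phi>)" using \<phi>(1) by (auto simp: pi11_def)
  then have "sat (\<lambda>i. \<sigma> i (\<lambda>_. zero)) S (comprehension_ax (AllS \<phi>))" by (rule comprehension_sat)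
  then obtain X where X: "mem x X \<longleftrightarrow>
      sat (case_nat x (\<lambda>i. \<sigma> i (\<lambda>_. zero))) (case_nat X S) (slift (AllS \<phi>))" for x
    unfolding comprehension_ax_def by (auto simp del: sren.simps)
  have P: "P x (ext Y) = sat (case_nat x (\<lambda>i. \<sigma> i (\<lambda>_. zero))) (case_nat Y S) \<phi>" for x Y
    using \<phi>(3) by blast
  have "mem x X \<longleftrightarrow> (\<forall>Y. P x (ext Y))" for x
    unfolding X sat_sren sat.simps nat.case P by (rule refl)
  then have "{x. \<forall>X. coded X \<longrightarrow> P x X} = ext X" by (auto simp: ext_def coded_def)
  then show ?thesis by (auto simp: coded_def)
qed

lemma coded_ex: "\<exists>X. coded X"
  by (auto simp: coded_def)

lemma coded_arith: "arith (\<lambda>e Y. P (e 0)) \<Longrightarrow> coded {x. P x}"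
  using coded_pi11[of "\<lambda>x _. P x"] coded_ex by simp

theorem coded_sigma11:
  assumes "arith (\<lambda>e Y. P (e 0) Y)"
  shows "coded {x. \<exists>X. coded X \<and> P x X}"
proof -
  have compl: "coded {x. x \<notin> Q}" if "coded Q" for Q by (intro coded_arith arith_intros that)
  have "coded {x. \<forall>X. coded X \<longrightarrow> \<not> P x X}" using assms by (intro coded_pi11 arith_not)
  from compl[OF this] show ?thesis by simp
qed

lemma coded_UNIV: "coded UNIV"
  using coded_arith[of "\<lambda>_. True", OF arith_const] by simp


section \<open>Arithmetic in the model\<close>

definition suc :: "'a \<Rightarrow> 'a" where
  "suc x = add x one"

text \<open>
  Induction for coded sets, from the instance of \<open>\<Sigma>\<^sup>0\<^sub>1\<close> induction for membership preceded by a
  vacuous quantifier.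
\<close>

lemma set_induct:
  assumes "coded Q" "zero \<in> Q" "\<And>x. x \<in> Q \<Longrightarrow> suc x \<in> Q"
  shows "x \<in> Q"
proof -
  obtain X where X: "Q = ext X" using assms(1) by (auto simp: coded_def)
  define \<phi> where "\<phi> = ExN (Mem (Var 1) 0)"
  have "sigma01 \<phi>" unfolding sigma01_def \<phi>_def using delta00.intros(3) by blast
  then have sat: "sat (\<lambda>_. zero) (\<lambda>_. X) (induction_ax \<phi>)" by (rule induction_sat)
  have "sat (\<lambda>_. zero) (\<lambda>_. X) (induction_ax \<phi>) \<longleftrightarrow>
      (mem zero X \<longrightarrow> \<not> (\<forall>x. mem x X \<longrightarrow> mem (add x one) X)) \<or> (\<forall>x. mem x X)"
    by (simp add: induction_ax_def \<phi>_def sat_nsub disj_imp)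
  then have ax: "mem zero X \<longrightarrow> (\<forall>x. mem x X \<longrightarrow> mem (add x one) X) \<longrightarrow> (\<forall>x. mem x X)"
    using sat by blast
  have "mem zero X" "\<forall>x. mem x X \<longrightarrow> mem (add x one) X"
    using assms(2,3) unfolding X ext_def suc_def mem_Collect_eq by blast+
  then have "\<forall>x. mem x X" using ax by blast
  then show ?thesis by (simp add: X ext_def)
qed

lemma semiring:
  shows add_comm: "add x y = add y x" and add_zero: "add x zero = x"
    and less_trans_imp: "x \<prec> y \<longrightarrow> y \<prec> z \<longrightarrow> x \<prec> z" and less_irrefl: "\<not> x \<prec> x"
    and linear: "x \<prec> y \<or> x = y \<or> y \<prec> x" and add_mono: "x \<prec> y \<longrightarrow> add x z \<prec> add y z"
    and less_imp_add: "x \<prec> y \<longrightarrow> (\<exists>u. add x u = y)" and zero_less_one: "zero \<prec> one"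
    and discrete: "zero \<prec> x \<longrightarrow> one = x \<or> one \<prec> x" and zero_least: "zero = x \<or> zero \<prec> x"
  by (insert semiring_axioms_sat[OF semiring_sat, of x y z]; elim conjE; assumption)+

lemma less_trans: "x \<prec> y \<Longrightarrow> y \<prec> z \<Longrightarrow> x \<prec> z"
  using less_trans_imp by blast

lemma not_le: "\<not> x \<preceq> y \<longleftrightarrow> y \<prec> x"
  using linear less_irrefl less_trans unfolding le_def by blast

lemma le_refl: "x \<preceq> x"
  by (simp add: le_def)

lemma zero_le: "zero \<preceq> x"
  using zero_least[of x] unfolding le_def by blast

lemma le_trans: "x \<preceq> y \<Longrightarrow> y \<preceq> z \<Longrightarrow> x \<preceq> z"
  by (auto simp: le_def intro: less_trans)

lemma le_less_trans: "x \<preceq> y \<Longrightarrow> y \<prec> z \<Longrightarrow> x \<prec> z"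
  by (auto simp: le_def intro: less_trans)

lemma less_le_trans: "x \<prec> y \<Longrightarrow> y \<preceq> z \<Longrightarrow> x \<prec> z"
  by (auto simp: le_def intro: less_trans)

lemma le_antisym: "x \<preceq> y \<Longrightarrow> y \<preceq> x \<Longrightarrow> x = y"
  by (metis le_def less_irrefl less_trans)

lemma less_imp_le: "x \<prec> y \<Longrightarrow> x \<preceq> y"
  by (simp add: le_def)

lemma less_suc: "x \<prec> suc x"
proof -
  have "add zero x \<prec> add one x" using add_mono zero_less_one by blast
  then show ?thesis by (simp add: suc_def add_comm[of _ x] add_zero)
qed

lemma suc_le: "x \<prec> y \<Longrightarrow> suc x \<preceq> y"
proof -
  assume xy: "x \<prec> y"
  then obtain u where u: "add x u = y" using less_imp_add by blast
  then have "u \<noteq> zero" using xy less_irrefl add_zero by auto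
  then have "one = u \<or> one \<prec> u" using discrete[of u] zero_least[of u] by simp
  then have "suc x = y \<or> add one x \<prec> add u x" using u add_mono by (auto simp: suc_def)
  then show ?thesis using u by (auto simp: le_def suc_def add_comm[of _ x])
qed

lemma less_suc_iff: "x \<prec> suc y \<longleftrightarrow> x \<preceq> y"
  by (metis le_less_trans less_suc not_le suc_le)

lemma ex_pred: "x \<noteq> zero \<Longrightarrow> \<exists>y. x = suc y"
proof -
  assume "x \<noteq> zero"
  then have "one = x \<or> one \<prec> x" using discrete[of x] zero_least[of x] by simp
  then show ?thesis
  proof
    assume "one = x"
    then have "x = suc zero" unfolding suc_def using add_comm[of zero one] add_zero[of one] by metis
    then show ?thesis by blast
  next
    assume "one \<prec> x"
    then obtain u where "add one u = x" using less_imp_add by blast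
    then have "x = suc u" using add_comm[of one u] by (simp add: suc_def)
    then show ?thesis by blast
  qed
qed

lemma least:
  assumes Q: "coded Q" and x: "x \<in> Q"
  shows "\<exists>y\<in>Q. \<forall>z\<in>Q. y \<preceq> z"
proof (rule ccontr)
  assume no: "\<not> ?thesis"
  let ?X = "{x. \<forall>z. z \<preceq> x \<longrightarrow> z \<notin> Q}"
  have "x \<in> ?X"
  proof (rule set_induct)
    show "coded ?X" by (intro coded_arith arith_intros Q)
    show "zero \<in> ?X" using no by (auto dest!: le_antisym[OF _ zero_le] intro: zero_le)
    show "suc y \<in> ?X" if "y \<in> ?X" for y
    proof -
      have "z \<notin> Q" if "z \<prec> suc y" for z
        using that \<open>y \<in> ?X\<close> by (simp add: less_suc_iff)
      moreover from this have "suc y \<notin> Q" using no not_le by blast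
      ultimately show ?thesis by (auto simp: le_def)
    qed
  qed
  then show False using x le_refl by auto
qed

lemma strong_induct:
  assumes Q: "coded Q" and step: "\<And>x. (\<And>y. y \<prec> x \<Longrightarrow> y \<in> Q) \<Longrightarrow> x \<in> Q"
  shows "x \<in> Q"
proof (rule ccontr)
  assume "x \<notin> Q"
  moreover have "coded {x. x \<notin> Q}" by (intro coded_arith arith_intros Q)
  ultimately obtain y where "y \<notin> Q" "\<And>z. z \<notin> Q \<Longrightarrow> y \<preceq> z"
    using least[of "{x. x \<notin> Q}" x] by auto
  then show False using step[of y] not_le by blast
qed

lemma greatest:
  assumes Q: "coded Q" and x: "x \<in> Q" and k: "\<And>z. z \<in> Q \<Longrightarrow> z \<preceq> k"
  shows "\<exists>y\<in>Q. \<forall>z\<in>Q. z \<preceq> y"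
proof -
  have "coded {b. \<forall>z\<in>Q. z \<preceq> b}" by (intro coded_arith arith_intros Q)
  then obtain b where b: "\<forall>z\<in>Q. z \<preceq> b" "\<And>c. \<forall>z\<in>Q. z \<preceq> c \<Longrightarrow> b \<preceq> c"
    using least[of "{b. \<forall>z\<in>Q. z \<preceq> b}" k] k by auto
  have "b \<in> Q"
  proof (rule ccontr)
    assume "b \<notin> Q"
    then have less: "\<And>z. z \<in> Q \<Longrightarrow> z \<prec> b" using b(1) by (auto simp: le_def)
    then have "b \<noteq> zero" using x not_le zero_le by blast
    then obtain c where c: "b = suc c" using ex_pred by blast
    then have "b \<preceq> c" using less by (intro b(2)) (auto simp: less_suc_iff)
    then show False using c less_suc not_le by blast
  qed
  then show ?thesis using b(1) by blast
qed

text \<open>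
  Bounded collection for conditions that are monotone along \<open>C\<close>.
\<close>

lemma collection:
  assumes C: "coded C" "c \<in> C" and K: "arith2 K"
    and mono: "\<And>c d m. c \<in> C \<Longrightarrow> d \<in> C \<Longrightarrow> c \<preceq> d \<Longrightarrow> K c m \<Longrightarrow> K d m"
    and ex: "\<And>m. m \<prec> k \<Longrightarrow> \<exists>c\<in>C. K c m"
  shows "\<exists>c\<in>C. \<forall>m. m \<prec> k \<longrightarrow> K c m"
proof -
  let ?J = "{j. j \<preceq> k \<longrightarrow> (\<exists>c\<in>C. \<forall>m. m \<prec> j \<longrightarrow> K c m)}"
  have "k \<in> ?J"
  proof (rule set_induct)
    show "coded ?J" by (intro coded_arith arith_intros C arith_arith2[OF K])
    show "zero \<in> ?J" using C(2) zero_le not_le by blast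
    show "suc j \<in> ?J" if "j \<in> ?J" for j
    proof (clarify)
      assume j: "suc j \<preceq> k"
      then have "j \<prec> k" using less_suc less_le_trans by blast
      then obtain c d where c: "c \<in> C" "\<And>m. m \<prec> j \<Longrightarrow> K c m" and d: "d \<in> C" "K d j"
        using \<open>j \<in> ?J\<close> ex less_imp_le by blast
      have m: "m \<prec> suc j \<longleftrightarrow> m \<prec> j \<or> m = j" for m by (simp add: less_suc_iff le_def)
      show "\<exists>c\<in>C. \<forall>m. m \<prec> suc j \<longrightarrow> K c m"
      proof (cases "c \<preceq> d")
        case True
        then show ?thesis using c d mono m by blast
      next
        case False
        then have "d \<preceq> c" using not_le less_imp_le by blast
        then show ?thesis using c d mono m by blast
      qed
    qed
  qed
  then show ?thesis using le_refl by blast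
qed

text \<open>
  The notion of an infinite set inside the structure.
\<close>

definition unbounded :: "'a set \<Rightarrow> bool" where
  "unbounded Q \<longleftrightarrow> (\<forall>k. \<exists>x\<in>Q. k \<prec> x)"

lemma unboundedI:
  assumes "coded Q" "x \<in> Q" "\<And>x. x \<in> Q \<Longrightarrow> \<exists>y\<in>Q. x \<prec> y"
  shows "unbounded Q"
  using greatest[OF assms(1,2)] assms(3) not_le unfolding unbounded_def by meson

text \<open>
  The set of iterates of \<open>S\<close>, always passing to the least admissible successor. It replaces
  definitions by primitive recursion. The last property says that \<open>C\<close> is enumerated by these steps:
  an element \<open>e\<close> larger than a given \<open>d \<in> C\<close> arises by a step from some \<open>c \<in> C\<close> that is \<open>d\<close> itself
  or larger.
\<close>

theorem orbit:
  assumes S: "arith2 S" and D: "coded D" "x\<^sub>0 \<in> D"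
    and step: "\<And>x. x \<in> D \<Longrightarrow> \<exists>y\<in>D. x \<prec> y \<and> S x y"
  obtains C where "coded C" "C \<subseteq> D" "x\<^sub>0 \<in> C" "unbounded C"
    "\<And>c. c \<in> C \<Longrightarrow> \<exists>e\<in>C. c \<prec> e \<and> S c e"
    "\<And>d e. d \<in> C \<Longrightarrow> e \<in> C \<Longrightarrow> d \<prec> e \<Longrightarrow> \<exists>c\<in>C. d \<preceq> c \<and> c \<prec> e \<and> S c e"
proof -
  \<comment> \<open>\<open>N x y\<close>: \<open>y\<close> is the least admissible successor of \<open>x\<close>; \<open>C\<close> is the closure of \<open>x\<^sub>0\<close> under \<open>N\<close>.\<close>
  define N where "N = (\<lambda>x y. y \<in> D \<and> x \<prec> y \<and> S x y \<and> (\<forall>z. z \<in> D \<and> x \<prec> z \<and> S x z \<longrightarrow> y \<preceq> z))"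
  have N2: "arith2 N" unfolding N_def arith2_def by (intro arith_intros D arith_arith2[OF S])
  have Nex: "\<exists>y. N x y" if "x \<in> D" for x
  proof -
    have "coded {y. y \<in> D \<and> x \<prec> y \<and> S x y}" by (intro coded_arith arith_intros D arith_arith2[OF S])
    then show ?thesis using step[OF that] least[of "{y. y \<in> D \<and> x \<prec> y \<and> S x y}"]
      unfolding N_def by auto
  qed
  have Nun: "y = z" if "N x y" "N x z" for x y z
    using that le_antisym unfolding N_def by blast
  define cl where "cl = (\<lambda>X. x\<^sub>0 \<in> X \<and> (\<forall>x\<in>X. \<forall>y. N x y \<longrightarrow> y \<in> X))"
  define C where "C = {x. \<forall>X. coded X \<longrightarrow> cl X \<longrightarrow> x \<in> X}"
  have C_coded: "coded C" unfolding C_def cl_def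
    by (intro coded_pi11 arith_intros arith_arith2[OF N2])
  have x0: "x\<^sub>0 \<in> C" by (auto simp: C_def cl_def)
  have Cstep: "y \<in> C" if "x \<in> C" "N x y" for x y
    using that unfolding C_def cl_def by blast
  have Cind: "x \<in> Q" if "x \<in> C" "coded Q" "x\<^sub>0 \<in> Q" "\<And>x y. x \<in> C \<Longrightarrow> x \<in> Q \<Longrightarrow> N x y \<Longrightarrow> y \<in> Q" for x Q
  proof -
    have "coded {x. x \<in> Q \<and> x \<in> C}" by (intro coded_arith arith_intros C_coded that(2))
    moreover have "cl {x. x \<in> Q \<and> x \<in> C}" using that(3,4) x0 Cstep by (auto simp: cl_def)
    ultimately show ?thesis using \<open>x \<in> C\<close> unfolding C_def by blast
  qed
  have CD: "x \<in> D" if "x \<in> C" for x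
    by (rule Cind[OF that D]) (auto simp: N_def)
  have succ: "\<exists>e\<in>C. N c e" if "c \<in> C" for c
    using Nex[OF CD[OF that]] Cstep[OF that] by blast
  have least0: "x\<^sub>0 \<preceq> x" if "x \<in> C" for x
  proof -
    have "x \<in> {x. x\<^sub>0 \<preceq> x}"
    proof (rule Cind[OF that])
      show "coded {x. x\<^sub>0 \<preceq> x}" by (intro coded_arith arith_intros)
      show "y \<in> {x. x\<^sub>0 \<preceq> x}" if "x \<in> {x. x\<^sub>0 \<preceq> x}" "N x y" for x y
        using that by (auto simp: N_def dest: less_imp_le intro: le_trans)
    qed (auto simp: le_refl)
    then show ?thesis by simp
  qed
  have pred: "\<exists>c\<in>C. N c e" if "e \<in> C" "e \<noteq> x\<^sub>0" for e
  proof -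
    let ?Q = "{e. e = x\<^sub>0 \<or> (\<exists>c\<in>C. N c e)}"
    have "e \<in> ?Q"
    proof (rule Cind[OF that(1)])
      show "coded ?Q" by (intro coded_arith arith_intros C_coded arith_arith2[OF N2])
    qed auto
    then show ?thesis using that by blast
  qed
  have gap: "d \<preceq> c \<or> e \<preceq> d" if "c \<in> C" "N c e" "d \<in> C" for c d e
  proof -
    let ?Q = "{d. \<forall>c\<in>C. \<forall>e. N c e \<longrightarrow> d \<preceq> c \<or> e \<preceq> d}"
    have "d \<in> ?Q"
    proof (rule Cind[OF that(3)])
      show "coded ?Q" by (intro coded_arith arith_intros C_coded arith_arith2[OF N2])
      show "x\<^sub>0 \<in> ?Q" using least0 by blast
      show "y \<in> ?Q" if x: "x \<in> C" "x \<in> ?Q" "N x y" for x y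
      proof -
        \<comment> \<open>No element of \<open>C\<close> lies strictly between \<open>x\<close> and \<open>y\<close>: the predecessor of the least
          one would be \<open>x\<close>.\<close>
        let ?B = "{c. c \<in> C \<and> x \<prec> c \<and> c \<prec> y}"
        have no_between: "c \<notin> ?B" for c
        proof
          assume "c \<in> ?B"
          moreover have "coded ?B" by (intro coded_arith arith_intros C_coded)
          ultimately obtain b where b: "b \<in> C" "x \<prec> b" "b \<prec> y" "\<And>z. z \<in> ?B \<Longrightarrow> b \<preceq> z"
            using least[of ?B c] by auto
          then have "b \<noteq> x\<^sub>0" using least0[OF x(1)] not_le by blast
          then obtain p where p: "p \<in> C" "N p b" using pred b(1) by blast
          then have "p \<prec> b" by (simp add: N_def)
          have "x \<preceq> p" using x(2) p b(2) not_le by blast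
          moreover have "\<not> x \<prec> p" using b(4)[of p] p(1) \<open>p \<prec> b\<close> b(3) less_trans not_le by blast
          ultimately have "p = x" by (auto simp: le_def)
          then show False using p(2) x(3) Nun b(3) less_irrefl by blast
        qed
        show ?thesis
        proof (clarify)
          fix c e assume c: "c \<in> C" "N c e" and e: "\<not> e \<preceq> y"
          show "y \<preceq> c"
          proof (rule ccontr)
            assume "\<not> y \<preceq> c"
            then have "c \<prec> y" by (simp add: not_le)
            have "x \<prec> y" using x(3) by (simp add: N_def)
            have "\<not> e \<preceq> x" using e \<open>x \<prec> y\<close> le_less_trans less_imp_le by blast
            then have "x \<preceq> c" using x(2) c by blast
            moreover have "x \<noteq> c" using Nun c(2) x(3) e le_refl by blast
            ultimately show False using no_between[of c] c(1) \<open>c \<prec> y\<close> by (simp add: le_def)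
          qed
        qed
      qed
    qed
    then show ?thesis using that by blast
  qed
  show ?thesis
  proof (rule that[OF C_coded _ x0])
    show "C \<subseteq> D" using CD by blast
    show "\<exists>e\<in>C. c \<prec> e \<and> S c e" if "c \<in> C" for c
      using succ[OF that] by (auto simp: N_def)
    show "unbounded C"
      by (rule unboundedI[OF C_coded x0]) (use succ in \<open>auto simp: N_def\<close>)
    show "\<exists>c\<in>C. d \<preceq> c \<and> c \<prec> e \<and> S c e" if de: "d \<in> C" "e \<in> C" "d \<prec> e" for d e
    proof -
      have "e \<noteq> x\<^sub>0" using de least0 not_le by blast
      then obtain c where c: "c \<in> C" "N c e" using pred[OF de(2)] by blast
      then have "d \<preceq> c" using gap[of c e d] de not_le by blast
      then show ?thesis using c by (auto simp: N_def)
    qed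
  qed
qed

end


section \<open>Partial orders without infinite antichains\<close>

text \<open>
  A strict partial order on the coded set \<open>P\<close>. The relation need not be confined to \<open>P\<close>.
\<close>

locale poset = pi11_model +
  fixes P :: "'a set" and r :: "'a \<Rightarrow> 'a \<Rightarrow> bool" (infix "\<sqsubset>" 50)
  assumes P: "coded P" and r: "arith2 r"
    and irrefl: "\<not> x \<sqsubset> x" and trans: "x \<sqsubset> y \<Longrightarrow> y \<sqsubset> z \<Longrightarrow> x \<sqsubset> z"
begin

definition wle :: "'a \<Rightarrow> 'a \<Rightarrow> bool" (infix "\<sqsubseteq>" 50) where
  "x \<sqsubseteq> y \<longleftrightarrow> x \<sqsubset> y \<or> x = y"

definition comparable :: "'a \<Rightarrow> 'a \<Rightarrow> bool" where
  "comparable x y \<longleftrightarrow> x \<sqsubseteq> y \<or> y \<sqsubseteq> x"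

text \<open>
  Neither this notion nor the next one includes that the set is coded.
\<close>

definition antichain :: "'a set \<Rightarrow> bool" where
  "antichain A \<longleftrightarrow> A \<subseteq> P \<and> (\<forall>x\<in>A. \<forall>y\<in>A. x \<noteq> y \<longrightarrow> \<not> comparable x y)"

text \<open>
  Unbounded \<open>(0,cof)\<close>-homogeneous chains. That cofinitely many elements of \<open>C\<close> have a property is
  expressed by a bound \<open>k\<close> beyond which all of them do.
\<close>

definition homogeneous_chain :: "'a set \<Rightarrow> bool" where
  "homogeneous_chain C \<longleftrightarrow> unbounded C \<and> C \<subseteq> P \<and> (\<forall>x\<in>C. \<forall>y\<in>C. comparable x y)
     \<and> (\<forall>p\<in>P. (\<forall>c\<in>C. \<not> comparable p c) \<or> (\<exists>k. \<forall>c\<in>C. k \<prec> c \<longrightarrow> comparable p c))"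

lemma arith_r: "slot t \<Longrightarrow> slot u \<Longrightarrow> arith (\<lambda>e Y. t e \<sqsubset> u e)"
  by (rule arith_arith2[OF r])

lemma arith_wle: "slot t \<Longrightarrow> slot u \<Longrightarrow> arith (\<lambda>e Y. t e \<sqsubseteq> u e)"
  unfolding wle_def by (intro arith_intros arith_r)

lemma arith_comparable: "slot t \<Longrightarrow> slot u \<Longrightarrow> arith (\<lambda>e Y. comparable (t e) (u e))"
  unfolding comparable_def by (intro arith_intros arith_wle)

lemmas arith_order = arith_r arith_wle arith_comparable

lemma wle_refl: "x \<sqsubseteq> x"
  by (simp add: wle_def)

lemma wle_trans: "x \<sqsubseteq> y \<Longrightarrow> y \<sqsubseteq> z \<Longrightarrow> x \<sqsubseteq> z"
  by (auto simp: wle_def intro: trans)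

lemma wle_r_trans: "x \<sqsubseteq> y \<Longrightarrow> y \<sqsubset> z \<Longrightarrow> x \<sqsubset> z"
  by (auto simp: wle_def intro: trans)

lemma not_r_wle: "x \<sqsubset> y \<Longrightarrow> \<not> y \<sqsubseteq> x"
  by (metis wle_def irrefl trans)

lemma comparable_sym: "comparable x y \<Longrightarrow> comparable y x"
  by (auto simp: comparable_def)

text \<open>
  The condition on \<open>S\<close> says that an admissible successor \<open>y\<close> of \<open>x\<close> is incomparable with all elements
  of \<open>D\<close> up to \<open>x\<close>, not just with \<open>x\<close>, so a step does not need to know the earlier choices.
\<close>

lemma greedy_antichain:
  assumes S: "arith2 S" and D: "coded D" "D \<subseteq> P" "x\<^sub>0 \<in> D"
    and step: "\<And>x. x \<in> D \<Longrightarrow> \<exists>y\<in>D. x \<prec> y \<and> S x y"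
    and S_incomparable:
      "\<And>d x y. d \<in> D \<Longrightarrow> x \<in> D \<Longrightarrow> y \<in> D \<Longrightarrow> d \<preceq> x \<Longrightarrow> S x y \<Longrightarrow> \<not> comparable d y"
  shows "\<exists>A. coded A \<and> unbounded A \<and> antichain A"
proof -
  obtain A where A: "coded A" "A \<subseteq> D" "unbounded A"
    "\<And>d e. d \<in> A \<Longrightarrow> e \<in> A \<Longrightarrow> d \<prec> e \<Longrightarrow> \<exists>c\<in>A. d \<preceq> c \<and> c \<prec> e \<and> S c e"
    using orbit[OF S D(1,3) step] by metis
  have less: "\<not> comparable d e" if "d \<in> A" "e \<in> A" "d \<prec> e" for d e
    using A(4)[OF that] A(2) S_incomparable that by blast
  have "\<not> comparable d e" if "d \<in> A" "e \<in> A" "d \<noteq> e" for d e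
    using linear[of d e] less[of d e] less[of e d] that comparable_sym by blast
  then show ?thesis using A D(2) unfolding antichain_def by blast
qed

text \<open>
  If some elements of \<open>Q\<close> have unboundedly many elements above them, the set above a maximal one of
  these can be taken.
\<close>

lemma unbounded_finite_above:
  assumes Q: "coded Q" "unbounded Q"
    and max: "\<And>X. coded X \<Longrightarrow> X \<subseteq> Q \<Longrightarrow> X \<noteq> {} \<Longrightarrow> \<exists>x\<in>X. \<forall>y\<in>X. \<not> x \<sqsubset> y"
  shows "\<exists>Q'. coded Q' \<and> unbounded Q' \<and> Q' \<subseteq> Q \<and> (\<forall>q\<in>Q'. \<exists>k. \<forall>x\<in>Q'. q \<sqsubset> x \<longrightarrow> x \<preceq> k)"
proof -
  define U where "U = {u. u \<in> Q \<and> (\<forall>k. \<exists>x\<in>Q. u \<sqsubset> x \<and> k \<prec> x)}"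
  show ?thesis
  proof (cases "U = {}")
    case True
    then have "\<exists>k. \<forall>x\<in>Q. q \<sqsubset> x \<longrightarrow> x \<preceq> k" if "q \<in> Q" for q
      using that not_le unfolding U_def by blast
    then show ?thesis using Q by blast
  next
    case False
    have "coded U" unfolding U_def by (intro coded_arith arith_intros arith_order Q)
    then obtain u where u: "u \<in> U" "\<And>y. y \<in> U \<Longrightarrow> \<not> u \<sqsubset> y"
      using max[of U] False by (auto simp: U_def)
    define Q' where "Q' = {x. x \<in> Q \<and> u \<sqsubset> x}"
    have "coded Q'" unfolding Q'_def by (intro coded_arith arith_intros arith_order Q)
    moreover have "unbounded Q'" using u(1) unfolding unbounded_def U_def Q'_def by blast
    moreover have "\<exists>k. \<forall>x\<in>Q'. q \<sqsubset> x \<longrightarrow> x \<preceq> k" if "q \<in> Q'" for q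
    proof -
      have "q \<notin> U" using u(2) that unfolding Q'_def by blast
      then show ?thesis using that not_le unfolding U_def Q'_def by blast
    qed
    ultimately show ?thesis unfolding Q'_def by blast
  qed
qed

text \<open>
  The upward ill-founded part of \<open>P\<close>, that is, the largest coded subset of \<open>P\<close> without
  maximal elements.
\<close>

definition Asc :: "'a set" where
  "Asc = {p. \<exists>X. coded X \<and> p \<in> X \<and> (\<forall>x\<in>X. x \<in> P \<and> (\<exists>y\<in>X. x \<sqsubset> y))}"

lemma coded_Asc: "coded Asc"
  unfolding Asc_def by (intro coded_sigma11 arith_intros arith_order P)

lemma Asc_P: "Asc \<subseteq> P"
  unfolding Asc_def by blast

lemma Asc_coinduct: "coded X \<Longrightarrow> X \<subseteq> P \<Longrightarrow> (\<And>x. x \<in> X \<Longrightarrow> \<exists>y\<in>X. x \<sqsubset> y) \<Longrightarrow> X \<subseteq> Asc"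
  unfolding Asc_def by blast

lemma Asc_step: "p \<in> Asc \<Longrightarrow> \<exists>q\<in>Asc. p \<sqsubset> q"
  unfolding Asc_def by blast

text \<open>
  Passing upwards in \<open>Asc\<close> leads to arbitrarily large numbers, for otherwise the elements of \<open>Asc\<close>
  above \<open>q\<close> would form a bounded set without maximal elements.
\<close>

lemma Asc_step_large:
  assumes "q \<in> Asc"
  shows "\<exists>n\<in>Asc. q \<sqsubset> n \<and> k \<prec> n"
proof (rule ccontr)
  assume "\<not> ?thesis"
  then have le_k: "n \<preceq> k" if "n \<in> Asc" "q \<sqsubset> n" for n using that not_le by blast
  define Z where "Z = {n. n \<in> Asc \<and> q \<sqsubset> n}"
  have Z: "coded Z" unfolding Z_def by (intro coded_arith arith_intros arith_order coded_Asc)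
  have Z_step: "\<exists>m\<in>Z. n \<sqsubset> m" if "n \<in> Z" for n
    using that Asc_step trans unfolding Z_def by blast
  \<comment> \<open>Going from an element to the least number above it in \<open>Z\<close> leads into \<open>W\<close>, and from an
    element of \<open>W\<close> to a larger number. So \<open>W\<close> has no greatest number, although it is bounded.\<close>
  define W where "W = {n. n \<in> Z \<and> (\<forall>i\<in>Z. n \<sqsubset> i \<longrightarrow> n \<prec> i)}"
  have W: "coded W" unfolding W_def by (intro coded_arith arith_intros arith_order Z)
  have W_step: "\<exists>m\<in>W. n \<sqsubset> m" if n: "n \<in> Z" for n
  proof -
    let ?A = "{i. i \<in> Z \<and> n \<sqsubset> i}"
    have "coded ?A" by (intro coded_arith arith_intros arith_order Z)
    moreover obtain m where "m \<in> ?A" using Z_step[OF n] by blast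
    ultimately have "\<exists>i\<in>?A. \<forall>j\<in>?A. i \<preceq> j" by (rule least)
    then obtain i where i: "i \<in> Z" "n \<sqsubset> i" "\<And>j. j \<in> Z \<Longrightarrow> n \<sqsubset> j \<Longrightarrow> i \<preceq> j" by blast
    have "i \<prec> j" if "j \<in> Z" "i \<sqsubset> j" for j
      using i(3)[of j] that i(2) trans irrefl unfolding le_def by blast
    then show ?thesis using i unfolding W_def by blast
  qed
  obtain z where "z \<in> Z" using Asc_step[OF assms] unfolding Z_def by blast
  then obtain w where "w \<in> W" using W_step by blast
  have "\<exists>y\<in>W. \<forall>z\<in>W. z \<preceq> y"
    by (rule greatest[OF W \<open>w \<in> W\<close>, of k]) (auto simp: W_def Z_def intro: le_k)
  then obtain g where g: "g \<in> W" "\<And>z. z \<in> W \<Longrightarrow> z \<preceq> g" by blast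
  then obtain m where m: "m \<in> W" "g \<sqsubset> m" using W_step unfolding W_def by blast
  then have "g \<prec> m" using g(1) unfolding W_def by blast
  then show False using g(2)[OF m(1)] not_le by blast
qed

text \<open>
  Candidates for being put below a later element of a chain in \<open>Asc\<close> that has reached \<open>c\<close>.
\<close>

definition cand :: "'a \<Rightarrow> 'a \<Rightarrow> bool" where
  "cand c m \<longleftrightarrow> m \<in> P \<and> \<not> m \<sqsubseteq> c \<and> (\<exists>q\<in>Asc. m \<sqsubseteq> q \<and> c \<sqsubseteq> q)"

lemma arith_cand: "slot t \<Longrightarrow> slot u \<Longrightarrow> arith (\<lambda>e Y. cand (t e) (u e))"
proof (rule arith_arith2)
  show "arith2 cand" unfolding cand_def arith2_def by (intro arith_intros arith_order P coded_Asc)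
qed

lemma cand_antimono: "c \<sqsubseteq> d \<Longrightarrow> cand d m \<Longrightarrow> cand c m"
  unfolding cand_def using wle_trans by blast

text \<open>
  The next element of the chain is above the least candidate. The least number that remains
  a candidate forever would be the least candidate from some point on, once the smaller numbers
  have dropped out, and would then lie below an element of the chain.
\<close>

lemma maximal_ascending_chain:
  assumes "Asc \<noteq> {}"
  obtains C c\<^sub>0 where "coded C" "C \<subseteq> Asc" "c\<^sub>0 \<in> C" "unbounded C"
    "\<And>c d. c \<in> C \<Longrightarrow> d \<in> C \<Longrightarrow> c \<prec> d \<Longrightarrow> c \<sqsubset> d"
    "\<And>m. m \<in> P \<Longrightarrow> (\<And>c. c \<in> C \<Longrightarrow> \<exists>q\<in>Asc. m \<sqsubseteq> q \<and> c \<sqsubseteq> q) \<Longrightarrow> \<exists>c\<in>C. m \<sqsubseteq> c"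
proof -
  obtain t where t: "t \<in> Asc" using assms by blast
  define S where "S = (\<lambda>c n. c \<sqsubset> n \<and>
    (\<exists>m. m \<sqsubseteq> n \<and> cand c m \<and> (\<forall>m'. m' \<prec> m \<longrightarrow> \<not> cand c m')))"
  have S: "arith2 S" unfolding S_def arith2_def by (intro arith_intros arith_order arith_cand)
  have step: "\<exists>n\<in>Asc. c \<prec> n \<and> S c n" if c: "c \<in> Asc" for c
  proof -
    obtain q where "q \<in> Asc" "c \<sqsubset> q" using Asc_step[OF c] by blast
    then have "cand c q" using Asc_P not_r_wle unfolding cand_def wle_def by blast
    moreover have "coded {m. cand c m}" by (intro coded_arith arith_intros arith_cand)
    ultimately obtain m where m: "cand c m" "\<And>m'. cand c m' \<Longrightarrow> m \<preceq> m'"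
      using least[of "{m. cand c m}" q] by auto
    then obtain q' where q': "q' \<in> Asc" "m \<sqsubseteq> q'" "c \<sqsubseteq> q'" unfolding cand_def by blast
    then obtain n where n: "n \<in> Asc" "q' \<sqsubset> n" "c \<prec> n" using Asc_step_large by blast
    have "c \<sqsubset> n" using q'(3) n(2) wle_r_trans by blast
    moreover have "m \<sqsubseteq> n" using q'(2) n(2) wle_r_trans unfolding wle_def[of m n] by blast
    ultimately have "S c n" unfolding S_def using m not_le by blast
    then show ?thesis using n by blast
  qed
  obtain C where C: "coded C" "C \<subseteq> Asc" "t \<in> C" "unbounded C"
    "\<And>c. c \<in> C \<Longrightarrow> \<exists>e\<in>C. c \<prec> e \<and> S c e"
    "\<And>d e. d \<in> C \<Longrightarrow> e \<in> C \<Longrightarrow> d \<prec> e \<Longrightarrow> \<exists>c\<in>C. d \<preceq> c \<and> c \<prec> e \<and> S c e"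
    using orbit[OF S coded_Asc t step] by metis
  have mono: "c \<sqsubset> d" if "c \<in> C" "d \<in> C" "c \<prec> d" for c d
  proof -
    let ?Q = "{d. d \<in> C \<longrightarrow> (\<forall>c\<in>C. c \<prec> d \<longrightarrow> c \<sqsubset> d)}"
    have "d \<in> ?Q"
    proof (rule strong_induct)
      show "coded ?Q" by (intro coded_arith arith_intros arith_order C)
      show "e \<in> ?Q" if IH: "\<And>y. y \<prec> e \<Longrightarrow> y \<in> ?Q" for e
      proof (clarify)
        fix c assume c: "e \<in> C" "c \<in> C" "c \<prec> e"
        then obtain b where b: "b \<in> C" "c \<preceq> b" "b \<prec> e" "S b e" using C(6)[of c e] by blast
        then have "c \<sqsubseteq> b" using IH[of b] c(2) unfolding le_def wle_def by blast
        then show "c \<sqsubset> e" using b(4) wle_r_trans unfolding S_def by blast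
      qed
    qed
    then show ?thesis using that by blast
  qed
  have wmono: "c \<sqsubseteq> d" if "c \<in> C" "d \<in> C" "c \<preceq> d" for c d
    using mono that unfolding le_def wle_def by blast
  have max: "\<exists>c\<in>C. m \<sqsubseteq> c" if m: "m \<in> P" "\<And>c. c \<in> C \<Longrightarrow> \<exists>q\<in>Asc. m \<sqsubseteq> q \<and> c \<sqsubseteq> q" for m
  proof (rule ccontr)
    assume "\<not> ?thesis"
    then have "m \<in> {m. \<forall>c\<in>C. cand c m}" using m unfolding cand_def by blast
    moreover have "coded {m. \<forall>c\<in>C. cand c m}" by (intro coded_arith arith_intros arith_cand C)
    ultimately obtain g where g: "\<And>c. c \<in> C \<Longrightarrow> cand c g"
      "\<And>m. \<forall>c\<in>C. cand c m \<Longrightarrow> g \<preceq> m"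
      using least[of "{m. \<forall>c\<in>C. cand c m}" m] by auto
    have "\<exists>c\<in>C. \<forall>m. m \<prec> g \<longrightarrow> \<not> cand c m"
    proof (rule collection[OF C(1,3)])
      show "arith2 (\<lambda>c m. \<not> cand c m)" unfolding arith2_def by (intro arith_intros arith_cand)
      show "\<not> cand d m" if "c \<in> C" "d \<in> C" "c \<preceq> d" "\<not> cand c m" for c d m
        using that wmono cand_antimono by blast
      show "\<exists>c\<in>C. \<not> cand c m" if "m \<prec> g" for m
        using that g(2) not_le by blast
    qed
    then obtain c where c: "c \<in> C" "\<And>m. m \<prec> g \<Longrightarrow> \<not> cand c m" by blast
    obtain e where e: "e \<in> C" "S c e" using C(5)[OF c(1)] by blast
    then obtain m' where m': "m' \<sqsubseteq> e" "cand c m'" "\<And>m. m \<prec> m' \<Longrightarrow> \<not> cand c m"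
      unfolding S_def by blast
    have "m' = g" using linear[of m' g] m'(2,3) c g(1) by blast
    then show False using m'(1) g(1)[OF e(1)] unfolding cand_def by blast
  qed
  show ?thesis by (rule that[OF C(1-4) mono max])
qed

text \<open>
  In the proof, \<open>B\<close> consists of the elements that can spoil the homogeneity of \<open>C\<close>, and \<open>M\<close> of the
  terminal elements of \<open>B\<close>. The condition \<open>good k b\<close> guarantees that \<open>b\<close> is incomparable with all
  elements of \<open>B\<close> above \<open>k\<close>.
\<close>

lemma ascending_case:
  assumes no_antichain: "\<not> (\<exists>A. coded A \<and> unbounded A \<and> antichain A)" and "Asc \<noteq> {}"
  shows "\<exists>C. coded C \<and> homogeneous_chain C"
proof -
  obtain C c\<^sub>0 where C: "coded C" "C \<subseteq> Asc" "c\<^sub>0 \<in> C" "unbounded C"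
    and mono: "\<And>c d. c \<in> C \<Longrightarrow> d \<in> C \<Longrightarrow> c \<prec> d \<Longrightarrow> c \<sqsubset> d"
    and max: "\<And>m. m \<in> P \<Longrightarrow> (\<And>c. c \<in> C \<Longrightarrow> \<exists>q\<in>Asc. m \<sqsubseteq> q \<and> c \<sqsubseteq> q) \<Longrightarrow> \<exists>c\<in>C. m \<sqsubseteq> c"
    using maximal_ascending_chain[OF \<open>Asc \<noteq> {}\<close>] by blast
  have wmono: "c \<sqsubseteq> d" if "c \<in> C" "d \<in> C" "c \<preceq> d" for c d
    using mono that unfolding le_def wle_def by blast
  define B where "B = {p. p \<in> P \<and> (\<forall>c\<in>C. \<not> p \<sqsubseteq> c) \<and> (\<exists>c\<in>C. \<not> c \<sqsubseteq> p)}"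
  have B: "coded B" unfolding B_def by (intro coded_arith arith_intros arith_order P C)
  define good where "good = (\<lambda>k b. \<not> k \<sqsubseteq> b \<and> (\<forall>q\<in>B. b \<sqsubset> q \<longrightarrow> \<not> k \<sqsubseteq> q))"
  have good: "arith2 good" unfolding good_def arith2_def by (intro arith_intros arith_order B)
  have good_mono: "good d b" if "c \<in> C" "d \<in> C" "c \<preceq> d" "good c b" for c d b
    using that wmono wle_trans unfolding good_def by blast
  define M where "M = {b. b \<in> B \<and> (\<exists>k\<in>C. \<forall>q\<in>B. b \<sqsubset> q \<longrightarrow> \<not> k \<sqsubseteq> q)}"
  have M: "coded M" unfolding M_def by (intro coded_arith arith_intros arith_order B C)
  have M_good: "\<exists>k\<in>C. good k b" if b: "b \<in> M" for b
  proof -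
    obtain k where k: "k \<in> C" "\<And>q. q \<in> B \<Longrightarrow> b \<sqsubset> q \<Longrightarrow> \<not> k \<sqsubseteq> q" and "b \<in> B"
      using b unfolding M_def by blast
    then obtain c where c: "c \<in> C" "\<not> c \<sqsubseteq> b" unfolding B_def by blast
    show ?thesis
    proof (cases "c \<preceq> k")
      case True
      then have "good k b" using k c wmono wle_trans unfolding good_def by blast
      then show ?thesis using k by blast
    next
      case False
      then have "k \<sqsubseteq> c" using c k not_le less_imp_le wmono by blast
      then have "good c b" using k c wle_trans unfolding good_def by blast
      then show ?thesis using c by blast
    qed
  qed
  show ?thesis
  proof (cases "\<exists>c\<in>C. \<forall>b\<in>M. \<not> c \<sqsubseteq> b")
    case True
    then obtain c where c: "c \<in> C" "\<And>b. b \<in> M \<Longrightarrow> \<not> c \<sqsubseteq> b" by blast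
    \<comment> \<open>The elements of \<open>B\<close> above \<open>c\<close> are not terminal, which is stronger than not being maximal:
      beyond each of them there are elements of \<open>Z \<subseteq> Asc\<close> above any given element of \<open>C\<close>.\<close>
    define Z where "Z = {b. b \<in> B \<and> c \<sqsubseteq> b}"
    have Z: "coded Z" unfolding Z_def by (intro coded_arith arith_intros arith_order B)
    have Z_step: "\<exists>q\<in>Z. b \<sqsubset> q \<and> k \<sqsubseteq> q" if bk: "b \<in> Z" "k \<in> C" for b k
    proof -
      have "b \<notin> M" using bk c unfolding Z_def by blast
      then obtain q where q: "q \<in> B" "b \<sqsubset> q" "k \<sqsubseteq> q" using bk unfolding M_def Z_def by blast
      then have "c \<sqsubseteq> q" using bk wle_r_trans unfolding Z_def wle_def[of c q] by blast
      then show ?thesis using q unfolding Z_def by blast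
    qed
    have "Z \<subseteq> Asc"
      by (rule Asc_coinduct[OF Z]) (use Z_step[OF _ c(1)] in \<open>auto simp: Z_def B_def\<close>)
    have Z_empty: "b \<notin> Z" for b
    proof
      assume b: "b \<in> Z"
      have "\<exists>d\<in>C. b \<sqsubseteq> d"
      proof (rule max)
        show "b \<in> P" using b unfolding Z_def B_def by blast
        show "\<exists>q\<in>Asc. b \<sqsubseteq> q \<and> k \<sqsubseteq> q" if "k \<in> C" for k
          using Z_step[OF b that] \<open>Z \<subseteq> Asc\<close> unfolding wle_def[of b] by blast
      qed
      then show False using b unfolding Z_def B_def by blast
    qed
    define C' where "C' = {d. d \<in> C \<and> c \<preceq> d}"
    have "coded C'" unfolding C'_def by (intro coded_arith arith_intros C)
    moreover have "homogeneous_chain C'"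
      unfolding homogeneous_chain_def
    proof (intro conjI ballI)
      show "unbounded C'"
        unfolding unbounded_def
      proof
        fix k
        obtain x where x: "x \<in> C" "k \<prec> x" using C(4) unfolding unbounded_def by blast
        show "\<exists>x\<in>C'. k \<prec> x"
        proof (cases "c \<preceq> x")
          case True
          then show ?thesis using x unfolding C'_def by blast
        next
          case False
          then have "x \<prec> c" by (simp add: not_le)
          then show ?thesis using x less_trans c(1) le_refl unfolding C'_def by blast
        qed
      qed
      show "C' \<subseteq> P" using C(2) Asc_P unfolding C'_def by blast
      show "comparable x y" if "x \<in> C'" "y \<in> C'" for x y
        using that linear[of x y] mono unfolding C'_def comparable_def wle_def by blast
      fix p assume p: "p \<in> P"
      consider (below) d where "d \<in> C" "p \<sqsubseteq> d" | (above) "\<And>d. d \<in> C \<Longrightarrow> d \<sqsubseteq> p" | (B) "p \<in> B"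
        using p unfolding B_def by blast
      then show "(\<forall>d\<in>C'. \<not> comparable p d) \<or> (\<exists>k. \<forall>d\<in>C'. k \<prec> d \<longrightarrow> comparable p d)"
      proof cases
        case below
        then have "\<forall>e\<in>C'. d \<prec> e \<longrightarrow> comparable p e"
          using wmono less_imp_le wle_trans unfolding C'_def comparable_def by blast
        then show ?thesis by blast
      next
        case above
        then show ?thesis unfolding C'_def comparable_def by blast
      next
        case B
        then have "\<not> c \<sqsubseteq> p" using Z_empty unfolding Z_def by blast
        then have "\<not> comparable p d" if "d \<in> C'" for d
          using that B wmono[OF c(1), of d] wle_trans unfolding C'_def comparable_def B_def by blast
        then show ?thesis by blast
      qed
    qed
    ultimately show ?thesis by blast
  next
    case False
    then have above: "\<exists>b\<in>M. c \<sqsubseteq> b" if "c \<in> C" for c using that by blast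
    \<comment> \<open>By collection, one \<open>k \<in> C\<close> is good for all terminal elements up to \<open>x\<close>; a terminal element
      above \<open>k\<close> is then a larger number than \<open>x\<close> and incomparable with all of these.\<close>
    define S where "S = (\<lambda>x y. \<exists>k\<in>C. k \<sqsubseteq> y \<and> (\<forall>d\<in>M. d \<preceq> x \<longrightarrow> good k d))"
    obtain b\<^sub>0 where b\<^sub>0: "b\<^sub>0 \<in> M" using above C(3) by blast
    have "\<exists>A. coded A \<and> unbounded A \<and> antichain A"
    proof (rule greedy_antichain[OF _ M _ b\<^sub>0])
      show "arith2 S" unfolding S_def arith2_def by (intro arith_intros arith_order arith_arith2[OF good] C M)
      show "M \<subseteq> P" unfolding M_def B_def by blast
      show "\<exists>y\<in>M. x \<prec> y \<and> S x y" if x: "x \<in> M" for x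
      proof -
        have "\<exists>k\<in>C. \<forall>d. d \<prec> suc x \<longrightarrow> (d \<in> M \<longrightarrow> good k d)"
        proof (rule collection[OF C(1,3)])
          show "arith2 (\<lambda>k d. d \<in> M \<longrightarrow> good k d)"
            unfolding arith2_def by (intro arith_intros arith_arith2[OF good] M)
        qed (use good_mono M_good C(3) in blast)+
        then obtain k where k: "k \<in> C" "\<And>d. d \<in> M \<Longrightarrow> d \<preceq> x \<Longrightarrow> good k d"
          unfolding less_suc_iff by blast
        obtain y where y: "y \<in> M" "k \<sqsubseteq> y" using above[OF k(1)] by blast
        have "x \<prec> y" using k(2)[OF y(1)] y(2) not_le unfolding good_def by blast
        then show ?thesis using y k unfolding S_def by blast
      qed
      show "\<not> comparable d y" if dxy: "d \<in> M" "x \<in> M" "y \<in> M" "d \<preceq> x" "S x y" for d x y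
      proof -
        obtain k where k: "k \<sqsubseteq> y" "good k d" using dxy unfolding S_def by blast
        have "\<not> y \<sqsubseteq> d" using k wle_trans unfolding good_def by blast
        moreover have "\<not> d \<sqsubset> y" using k dxy(3) unfolding good_def M_def by blast
        ultimately show ?thesis using wle_refl unfolding comparable_def wle_def[of d] by blast
      qed
    qed
    then show ?thesis using no_antichain by blast
  qed
qed

end

sublocale poset \<subseteq> dual: poset zero one add mul less mem P "\<lambda>x y. r y x"
  by unfold_locales (use P r irrefl trans arith2_converse in blast)+

context poset
begin

lemma dual_wle: "dual.wle x y \<longleftrightarrow> y \<sqsubseteq> x"
  unfolding dual.wle_def wle_def by blast

lemma dual_comparable: "dual.comparable = comparable"
  unfolding dual.comparable_def[abs_def] comparable_def[abs_def] dual_wle by blast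

lemma dual_antichain: "dual.antichain = antichain"
  unfolding dual.antichain_def[abs_def] antichain_def[abs_def] dual_comparable ..

lemma dual_homogeneous_chain: "dual.homogeneous_chain = homogeneous_chain"
  unfolding dual.homogeneous_chain_def[abs_def] homogeneous_chain_def[abs_def] dual_comparable ..

theorem homogeneous_chain_exists:
  assumes "unbounded P" and no_antichain: "\<not> (\<exists>A. coded A \<and> unbounded A \<and> antichain A)"
  shows "\<exists>C. coded C \<and> homogeneous_chain C"
proof -
  consider "Asc \<noteq> {}" | "dual.Asc \<noteq> {}" | (wf) "Asc = {}" "dual.Asc = {}" by blast
  then show ?thesis
  proof cases
    case 1
    then show ?thesis using ascending_case no_antichain by blast
  next
    case 2
    then show ?thesis
      using dual.ascending_case no_antichain unfolding dual_antichain dual_homogeneous_chain by blast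
  next
    case wf
    have max: "\<exists>x\<in>X. \<forall>y\<in>X. \<not> x \<sqsubset> y" if "coded X" "X \<subseteq> P" "X \<noteq> {}" for X
      using Asc_coinduct[of X] that wf(1) by blast
    have min: "\<exists>x\<in>X. \<forall>y\<in>X. \<not> y \<sqsubset> x" if "coded X" "X \<subseteq> P" "X \<noteq> {}" for X
      using dual.Asc_coinduct[of X] that wf(2) by blast
    \<comment> \<open>First each element of \<open>Q\<close> has boundedly many elements of \<open>Q\<close> above it, and then each
      element of \<open>D\<close> also has boundedly many elements of \<open>D\<close> below it.\<close>
    obtain Q where Q: "coded Q" "unbounded Q" "Q \<subseteq> P" "\<forall>q\<in>Q. \<exists>k. \<forall>x\<in>Q. q \<sqsubset> x \<longrightarrow> x \<preceq> k"
      using unbounded_finite_above[OF P \<open>unbounded P\<close> max] by blast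
    have "\<exists>x\<in>X. \<forall>y\<in>X. \<not> y \<sqsubset> x" if "coded X" "X \<subseteq> Q" "X \<noteq> {}" for X
      using min that Q(3) by blast
    from dual.unbounded_finite_above[OF Q(1,2) this]
    obtain D where D: "coded D" "unbounded D" "D \<subseteq> Q" "\<forall>q\<in>D. \<exists>k. \<forall>x\<in>D. x \<sqsubset> q \<longrightarrow> x \<preceq> k"
      by blast
    define K where "K = (\<lambda>k d. d \<in> D \<longrightarrow> (\<forall>x\<in>D. k \<prec> x \<longrightarrow> \<not> comparable d x))"
    have K: "arith2 K" unfolding K_def arith2_def by (intro arith_intros arith_order D)
    have K_ex: "\<exists>k. K k d" for d
    proof (cases "d \<in> D")
      case True
      then obtain k l where k: "\<And>x. x \<in> D \<Longrightarrow> d \<sqsubset> x \<Longrightarrow> x \<preceq> k" "\<And>x. x \<in> D \<Longrightarrow> x \<sqsubset> d \<Longrightarrow> x \<preceq> l"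
        using Q(4) D(3,4) by blast
      obtain m where m: "k \<preceq> m" "l \<preceq> m" "d \<preceq> m" 
        using le_refl le_trans not_le less_imp_le by metis
      have "\<not> comparable d x" if "x \<in> D" "m \<prec> x" for x
        using k[OF that(1)] m that(2) le_trans not_le unfolding comparable_def wle_def by blast
      then show ?thesis unfolding K_def by blast
    qed (simp add: K_def)
    define S where "S = (\<lambda>x y. \<forall>d\<in>D. d \<preceq> x \<longrightarrow> \<not> comparable d y)"
    obtain d\<^sub>0 where d\<^sub>0: "d\<^sub>0 \<in> D" using D(2) unfolding unbounded_def by blast
    have "\<exists>A. coded A \<and> unbounded A \<and> antichain A"
    proof (rule greedy_antichain[OF _ D(1) _ d\<^sub>0])
      show "arith2 S" unfolding S_def arith2_def by (intro arith_intros arith_order D)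
      show "D \<subseteq> P" using D(3) Q(3) by blast
      show "\<exists>y\<in>D. x \<prec> y \<and> S x y" if "x \<in> D" for x
      proof -
        have "\<exists>k\<in>UNIV. \<forall>d. d \<prec> suc x \<longrightarrow> K k d"
          by (rule collection[OF coded_UNIV UNIV_I[of zero] K])
            (use K_ex in \<open>auto simp: K_def intro: le_less_trans\<close>)
        then obtain k where k: "\<And>d. d \<preceq> x \<Longrightarrow> K k d" unfolding less_suc_iff by blast
        obtain m where m: "k \<preceq> m" "x \<preceq> m" using le_refl not_le less_imp_le by metis
        obtain y where y: "y \<in> D" "m \<prec> y" using D(2) unfolding unbounded_def by blast
        have "S x y" using k y m le_less_trans unfolding S_def K_def by blast
        then show ?thesis using y m le_less_trans by blast
      qed
      show "\<not> comparable d y" if "d \<in> D" "x \<in> D" "y \<in> D" "d \<preceq> x" "S x y" for d x y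
        using that unfolding S_def by blast
    qed
    then show ?thesis using no_antichain by blast
  qed
qed

end


section \<open>The principle in the formal system\<close>

context pi11_model
begin

definition pair :: "'a \<Rightarrow> 'a \<Rightarrow> 'a" where
  "pair x y = add (mul (add x y) (add x y)) x"

text \<open>
  The binary relation on numbers that a set object codes.
\<close>

definition rel :: "'s \<Rightarrow> 'a \<Rightarrow> 'a \<Rightarrow> bool" where
  "rel R x y \<longleftrightarrow> mem (pair x y) R"

lemma arith2_rel: "arith2 (rel R)"
  unfolding arith2_def
  by (rule arithI[of "rel_fm 1 (Var 0) (Var 1)" "\<lambda>i e. e i" _ "\<lambda>_. R"])
    (auto simp: rel_fm_def pair_tm_def rel_def pair_def slot_var)

lemma sat_rel: "sat e S (rel_fm R s t) \<longleftrightarrow> rel (S R) (ev e s) (ev e t)"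
  by (simp add: rel_fm_def pair_tm_def rel_def pair_def)

lemma sat_comparable: "sat e S (comparable_fm R s t) \<longleftrightarrow>
    (rel (S R) (ev e s) (ev e t) \<or> ev e s = ev e t) \<or> (rel (S R) (ev e t) (ev e s) \<or> ev e t = ev e s)"
  by (simp add: comparable_fm_def leq_fm_def sat_rel) blast

lemma sat_infinite: "sat e S (infinite_fm X) \<longleftrightarrow> unbounded (ext (S X))"
  by (simp add: infinite_fm_def unbounded_def ext_def) blast

lemma sat_subset: "sat e S (subset_fm X Y) \<longleftrightarrow> ext (S X) \<subseteq> ext (S Y)"
  by (auto simp: subset_fm_def ext_def)

lemma sat_partial_order:
  assumes "sat e S (partial_order_fm P R)"
  shows "\<not> rel (S R) x x" and "rel (S R) x y \<Longrightarrow> rel (S R) y z \<Longrightarrow> rel (S R) x z"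
proof -
  have order: "\<forall>x. \<not> rel (S R) x x" "\<forall>x y z. rel (S R) x y \<and> rel (S R) y z \<longrightarrow> rel (S R) x z"
    using assms unfolding partial_order_fm_def by (auto simp: sat_rel numeral_2_eq_2)
  show "\<not> rel (S R) x x" "rel (S R) x y \<Longrightarrow> rel (S R) y z \<Longrightarrow> rel (S R) x z"
    using order by blast+
qed

theorem principle_sat: "sat e S homogeneous_chain_principle"
proof -
  have "\<exists>C. sat e (case_nat C U) (zero_cof_homogeneous_chain_fm 2 1 0)"
    if U: "sat e U (partial_order_fm 1 0)" "sat e U (infinite_fm 1)"
      and no: "\<And>A. sat e (case_nat A U) (infinite_fm 0) \<Longrightarrow> \<not> sat e (case_nat A U) (antichain_fm 2 1 0)"
    for U
  proof -
    interpret poset zero one add mul less mem "ext (U 1)" "rel (U 0)"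
    proof
      note order = sat_partial_order[OF U(1)]
      show "coded (ext (U 1))" by (simp add: coded_def)
      show "arith2 (rel (U 0))" by (rule arith2_rel)
      show "\<not> rel (U 0) x x" for x by (rule order(1))
      show "rel (U 0) x z" if "rel (U 0) x y" "rel (U 0) y z" for x y z using that by (rule order(2))
    qed
    have comp: "sat e' (case_nat A U) (comparable_fm (Suc 0) s t) \<longleftrightarrow> comparable (ev e' s) (ev e' t)"
      for e' A s t
      by (simp add: sat_comparable comparable_def wle_def)
    have "\<not> antichain A" if A: "coded A" "unbounded A" for A
    proof
      assume anti: "antichain A"
      obtain X where X: "A = ext X" using A(1) by (auto simp: coded_def)
      have "sat e (case_nat X U) (infinite_fm 0)" using A(2) by (simp add: sat_infinite X)
      moreover have "sat e (case_nat X U) (antichain_fm 2 1 0)"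
        using anti unfolding antichain_fm_def antichain_def X
        by (auto simp: sat_subset comp ext_def numeral_2_eq_2)
      ultimately show False using no by blast
    qed
    moreover have "unbounded (ext (U 1))" using U(2) by (simp add: sat_infinite)
    ultimately obtain C where C: "coded C" "homogeneous_chain C"
      using homogeneous_chain_exists by blast
    obtain X where X: "C = ext X" using C(1) by (auto simp: coded_def)
    have "sat e (case_nat X U) (zero_cof_homogeneous_chain_fm 2 1 0)"
      using C(2) unfolding zero_cof_homogeneous_chain_fm_def chain_fm_def homogeneous_chain_def X
      by (simp add: sat_subset sat_infinite comp) (auto simp: ext_def numeral_2_eq_2)
    then show ?thesis by blast
  qed
  then show ?thesis unfolding homogeneous_chain_principle_def by (simp del: One_nat_def)
qed

end

lemma closed_at_AllN_pow: "closed_at (k + n) m \<phi> \<Longrightarrow> closed_at k m ((AllN ^^ n) \<phi>)"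
  by (induction n arbitrary: k) auto

lemma closed_at_AllS_pow: "closed_at n (k + m) \<phi> \<Longrightarrow> closed_at n k ((AllS ^^ m) \<phi>)"
  by (induction m arbitrary: k) auto

lemma closed_univ_closures: "\<psi> \<in> univ_closures \<phi> \<Longrightarrow> closed_at 0 0 \<psi>"
  unfolding univ_closures_def
  using closed_at_AllN_pow[of 0] closed_at_AllS_pow[of _ 0] by auto

lemma pi11_model_of_axioms:
  fixes zero one :: 'a and add mul :: "'a \<Rightarrow> 'a \<Rightarrow> 'a" and less :: "'a \<Rightarrow> 'a \<Rightarrow> bool"
    and mem :: "'a \<Rightarrow> 's \<Rightarrow> bool"
  assumes "\<And>\<psi> e S. \<psi> \<in> Pi11CA0 \<Longrightarrow> l2_structure.sat zero one add mul less (=) mem e S \<psi>"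
  shows "pi11_model zero one add mul less mem"
proof -
  interpret l2_structure zero one add mul less "(=)" mem .
  have sat: "sat e S \<phi>" if "univ_closures \<phi> \<subseteq> Pi11CA0" for \<phi> e S
    by (rule sat_univ_closures, rule assms) (use that in blast)
  show ?thesis
  proof
    show "\<forall>\<psi>\<in>semiring_axioms. \<forall>e. sat e S \<psi>" for S
      using sat unfolding Pi11CA0_def RCA0_def by blast
    show "sat e S (induction_ax \<phi>)" if "sigma01 \<phi>" for e S \<phi>
      by (rule sat) (use that in \<open>unfold Pi11CA0_def RCA0_def, blast\<close>)
    show "sat e S (comprehension_ax \<phi>)" if "pi11 \<phi>" for e S \<phi>
      by (rule sat) (use that in \<open>unfold Pi11CA0_def, blast\<close>)
  qed
qed

theorem theorem7p2:
  shows "Pi11CA0 \<turnstile> homogeneous_chain_principle"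
proof (rule completeness)
  show "closed_at 0 0 \<psi>" if "\<psi> \<in> Pi11CA0" for \<psi>
    using that closed_univ_closures unfolding Pi11CA0_def RCA0_def by blast
  show "closed_at 0 0 homogeneous_chain_principle"
    by (simp add: homogeneous_chain_principle_def partial_order_fm_def infinite_fm_def
        antichain_fm_def zero_cof_homogeneous_chain_fm_def chain_fm_def subset_fm_def
        comparable_fm_def leq_fm_def rel_fm_def pair_tm_def)
  show "(\<Union>\<psi>\<in>semiring_axioms. univ_closures \<psi>) \<subseteq> Pi11CA0"
    unfolding Pi11CA0_def RCA0_def by blast
next
  fix zero one :: nat and add mul less and mem :: "nat \<Rightarrow> nat \<Rightarrow> bool" and e S
  assume sat: "\<And>\<psi> e S. \<psi> \<in> Pi11CA0 \<Longrightarrow> l2_structure.sat zero one add mul less (=) mem e S \<psi>"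
  interpret pi11_model zero one add mul less mem by (rule pi11_model_of_axioms) (rule sat)
  show "sat e S homogeneous_chain_principle" by (rule principle_sat)
qed

end
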